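(* Consider the system of Hammerstein integral equations $$u(t)=\int_{0}^{1}k_{1}(t,s)g_{1}(s)f_{1}(s,u(s),u'(s),v(s),v'(s))\,ds,\qquad v(t)=\int_{0}^{1}k_{2}(t,s)g_{2}(s)f_{2}(s,u(s),u'(s),v(s),v'(s))\,ds,$$ for $t\in[0,1]$, where $k_i,g_i,f_i$ ($i=1,2$) satisfy the assumptions (A1)–(A4) of the context. Let $K$, the constants $c_i$, and the conditions $(\mathrm I^{0}_{\rho_1,\rho_2})$ and $(\mathrm I^{1}_{\rho_1,\rho_2})$ be as defined in the context. The system has at least one nontrivial solution in $K$ if one of the following conditions holds. $(S_1)$ For $i=1,2$ there exist $\rho_i,r_i\in(0,\infty)$ with $\rho_i/c_i<r_i$ such that $(\mathrm I^{0}_{\rho_1,\rho_2})$ and $(\mathrm I^{1}_{r_1,r_2})$ hold. $(S_2)$ For $i=1,2$ there exist $\rho_i,r_i\in(0,\infty)$ with $\rho_i<r_i$ such that $(\mathrm I^{1}_{\rho_1,\rho_2})$ and $(\mathrm I^{0}_{r_1,r_2})$ hold. The system has at least two nontrivial solutions in $K$ if one of the following conditions holds. $(S_3)$ For $i=1,2$ there exist $\rho_i,r_i,s_i\in(0,\infty)$ with $\rho_i/c_i<r_i<s_i$ such that $(\mathrm I^{0}_{\rho_1,\rho_2})$, $(\mathrm I^{1}_{r_1,r_2})$ and $(\mathrm I^{0}_{s_1,s_2})$ hold. $(S_4)$ For $i=1,2$ there exist $\rho_i,r_i,s_i\in(0,\infty)$ with $\rho_i<r_i$ and $r_i/c_i<s_i$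 such that $(\mathrm I^{1}_{\rho_1,\rho_2})$, $(\mathrm I^{0}_{r_1,r_2})$ and $(\mathrm I^{1}_{s_1,s_2})$ hold. The system has at least three nontrivial solutions in $K$ if one of the following conditions holds. $(S_5)$ For $i=1,2$ there exist $\rho_i,r_i,s_i,\sigma_i\in(0,\infty)$ with $\rho_i/c_i<r_i<s_i$ and $s_i/c_i<\sigma_i$ such that $(\mathrm I^{0}_{\rho_1,\rho_2})$, $(\mathrm I^{1}_{r_1,r_2})$, $(\mathrm I^{0}_{s_1,s_2})$ and $(\mathrm I^{1}_{\sigma_1,\sigma_2})$ hold. $(S_6)$ For $i=1,2$ there exist $\rho_i,r_i,s_i,\sigma_i\in(0,\infty)$ with $\rho_i<r_i$ and $r_i/c_i<s_i<\sigma_i$ such that $(\mathrm I^{1}_{\rho_1,\rho_2})$, $(\mathrm I^{0}_{r_1,r_2})$, $(\mathrm I^{1}_{s_1,s_2})$ and $(\mathrm I^{0}_{\sigma_1,\sigma_2})$ hold.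
   Context: Standing assumptions. (A1) For $i=1,2$, $f_i:[0,1]\times\mathbb R^4\to[0,+\infty)$ is $L^\infty$-Carathéodory: $f_i(\cdot,u_1,u_2,v_1,v_2)$ is measurable for each fixed $(u_1,u_2,v_1,v_2)$, $f_i(t,\cdot,\cdot,\cdot,\cdot)$ is continuous for a.e. $t\in[0,1]$, and for each $r>0$ there exists $\varphi_{i,r}\in L^\infty[0,1]$ such that $f_i(t,u_1,u_2,v_1,v_2)\le\varphi_{i,r}(t)$ for $u_1,u_2,v_1,v_2\in[-r,r]$ and a.e. $t\in[0,1]$. (A2) For $i=1,2$, $k_i:[0,1]^2\to\mathbb R$ is measurable, and for all $\tau\in[0,1]$ we have $\lim_{t\to\tau}|k_i(t,s)-k_i(\tau,s)|=0$ for a.e. $s\in[0,1]$ and $\lim_{t\to\tau}\left|\frac{\partial k_i}{\partial t}(t,s)-\frac{\partial k_i}{\partial t}(\tau,s)\right|=0$ for a.e. $s\in[0,1]$. (A3) For $i=1,2$, there exist subintervals $[a_i,b_i],[\gamma_i,\delta_i]\subseteq[0,1]$, functions $\phi_i,\psi_i\in L^\infty[0,1]$ and constants $c_i,d_i\in(0,1]$ such that, for a.e. $s\in[0,1]$: $|k_i(t,s)|\le\phi_i(s)$ for $t\in[0,1]$; $\left|\frac{\partial k_i}{\partial t}(t,s)\right|\le\psi_i(s)$ for $t\in[0,1]$; $k_i(t,s)\ge c_i\phi_i(s)$ for $t\in[a_i,b_i]$; $\frac{\partial k_i}{\partial t}(t,s)\ge d_i\psi_i(s)$ for $t\in[\gamma_i,\delta_i]$.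 (A4) For $i=1,2$, $g_i\in L^1[0,1]$, $g_i(t)\ge0$ for a.e. $t\in[0,1]$, $\int_{a_i}^{b_i}\phi_i(s)g_i(s)\,ds>0$ and $\int_{\gamma_i}^{\delta_i}\psi_i(s)g_i(s)\,ds>0$. Space and cone. $\|w\|_C:=\max_{t\in[0,1]}|w(t)|$, $\|w\|_{C^1}:=\max\{\|w\|_C,\|w'\|_C\}$, and $(C^1[0,1])^2$ has the norm $\|(u,v)\|:=\max\{\|u\|_{C^1},\|v\|_{C^1}\}$. Set $$\tilde K_i:=\Big\{w\in C^1[0,1]:\min_{t\in[a_i,b_i]}w(t)\ge c_i\|w\|_C,\ \min_{t\in[\gamma_i,\delta_i]}w'(t)\ge d_i\|w'\|_C\Big\},\qquad K:=\tilde K_1\times\tilde K_2.$$ A nontrivial solution of the system is a solution $(u,v)\in K$ with $\|(u,v)\|\ne0$. Constants. For $i=1,2$, $$\frac1{m_i}:=\max_{t\in[0,1]}\int_0^1|k_i(t,s)|g_i(s)\,ds,\qquad \frac1{m_i^*}:=\max_{t\in[0,1]}\int_0^1\left|\frac{\partial k_i}{\partial t}(t,s)\right|g_i(s)\,ds,$$ $$\frac1{M_i}:=\min_{t\in[a_i,b_i]}\int_{a_i}^{b_i}k_i(t,s)g_i(s)\,ds,\qquad \frac1{M_i^*}:=\min_{t\in[\gamma_i,\delta_i]}\int_{\gamma_i}^{\delta_i}\frac{\partial k_i}{\partial t}(t,s)g_i(s)\,ds.$$ Conditions. For $\rho_1,\rho_2>0$: $(\mathrm I^{1}_{\rho_1,\rho_2})$: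 for $i=1,2$, $f_i^{\rho_1,\rho_2}<\min\{m_i,m_i^*\}$, where $$f_i^{\rho_1,\rho_2}:=\sup\Big\{\tfrac{f_i(t,u_1,u_2,v_1,v_2)}{\rho_i}:(t,u_1,u_2,v_1,v_2)\in[0,1]\times[-\rho_1,\rho_1]^2\times[-\rho_2,\rho_2]^2\Big\}.$$ $(\mathrm I^{0}_{\rho_1,\rho_2})$: $f_{1,(\rho_1,\rho_2)}>M_1$, $f^*_{1,(\rho_1,\rho_2)}>M_1^*$, $f_{2,(\rho_1,\rho_2)}>M_2$, $f^*_{2,(\rho_1,\rho_2)}>M_2^*$, where $f_{1,(\rho_1,\rho_2)}$ is the infimum of $f_1(t,u_1,u_2,v_1,v_2)/\rho_1$ over $[a_1,b_1]\times[c_1\rho_1,\rho_1]\times[-\rho_1,\rho_1]\times[-\rho_2,\rho_2]^2$; $f^*_{1,(\rho_1,\rho_2)}$ is the infimum of $f_1(t,u_1,u_2,v_1,v_2)/\rho_1$ over $[\gamma_1,\delta_1]\times[-\rho_1,\rho_1]\times[d_1\rho_1,\rho_1]\times[-\rho_2,\rho_2]^2$; $f_{2,(\rho_1,\rho_2)}$ is the infimum of $f_2(t,u_1,u_2,v_1,v_2)/\rho_2$ over $[a_2,b_2]\times[-\rho_1,\rho_1]^2\times[c_2\rho_2,\rho_2]\times[-\rho_2,\rho_2]$; $f^*_{2,(\rho_1,\rho_2)}$ is the infimum of $f_2(t,u_1,u_2,v_1,v_2)/\rho_2$ over $[\gamma_2,\delta_2]\times[-\rho_1,\rho_1]^2\times[-\rho_2,\rho_2]\times[d_2\rho_2,\rho_2]$.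 (In each product the order of the variables is $(t,u_1,u_2,v_1,v_2)$.) *)

theory Defs
  imports "HOL-Analysis.Analysis"
begin

text \<open>
  The two components of the system are indexed by \<open>i \<in> {1, 2}\<close> as in the text; families are functions
  on \<^typ>\<open>nat\<close> and their values outside \<open>{1, 2}\<close> play no role. A nonlinearity takes the point
  \<open>(u\<^sub>1, u\<^sub>2, v\<^sub>1, v\<^sub>2)\<close> as a tuple. Measurability, \<open>L\<^sup>1\<close>, \<open>L\<^sup>\<infinity>\<close>, integrals and
  ``almost everywhere'' refer to Lebesgue measure.
\<close>

type_synonym real4 = "real \<times> real \<times> real \<times> real"

text \<open>The derivative relative to \<open>[0,1]\<close>, hence one-sided at the endpoints.\<close>

definition D01 :: "(real \<Rightarrow> real) \<Rightarrow> real \<Rightarrow> real" where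
  "D01 w t = vector_derivative w (at t within {0..1})"

definition pdt :: "(real \<Rightarrow> real \<Rightarrow> real) \<Rightarrow> real \<Rightarrow> real \<Rightarrow> real" where
  "pdt k t s = D01 (\<lambda>x. k x s) t"

definition Linfty01 :: "(real \<Rightarrow> real) set" where
  "Linfty01 = {h \<in> borel_measurable (lebesgue_on {0..1}).
                 \<exists>C. AE t in lebesgue_on {0..1}. \<bar>h t\<bar> \<le> C}"


definition assm_A1 :: "(nat \<Rightarrow> real \<Rightarrow> real4 \<Rightarrow> real) \<Rightarrow> bool" where
  "assm_A1 f \<longleftrightarrow> (\<forall>i\<in>{1,2}.
     (\<forall>t\<in>{0..1}. \<forall>x. 0 \<le> f i t x) \<and>
     (\<forall>x. (\<lambda>t. f i t x) \<in> borel_measurable (lebesgue_on {0..1})) \<and>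
     (AE t in lebesgue_on {0..1}. continuous_on UNIV (f i t)) \<and>
     (\<forall>r>0. \<exists>h\<in>Linfty01. AE t in lebesgue_on {0..1}.
        \<forall>x \<in> {-r..r} \<times> {-r..r} \<times> {-r..r} \<times> {-r..r}. f i t x \<le> h t))"

text \<open>
  The use of the partial derivative at all \<open>t \<in> [0,1]\<close> for almost every \<open>s\<close> presupposes its
  existence there; the second conjunct makes this explicit. In the two limit conditions the
  exceptional null set of \<open>s\<close> may depend on \<open>\<tau>\<close>.
\<close>

definition assm_A2 :: "(nat \<Rightarrow> real \<Rightarrow> real \<Rightarrow> real) \<Rightarrow> bool" where
  "assm_A2 k \<longleftrightarrow> (\<forall>i\<in>{1,2}.
     (\<lambda>(t, s). k i t s) \<in> borel_measurable (lebesgue_on ({0..1} \<times> {0..1})) \<and>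
     (AE s in lebesgue_on {0..1}. \<forall>t\<in>{0..1}. (\<lambda>x. k i x s) differentiable (at t within {0..1})) \<and>
     (\<forall>\<tau>\<in>{0..1}.
        (AE s in lebesgue_on {0..1}.
           ((\<lambda>t. \<bar>k i t s - k i \<tau> s\<bar>) \<longlongrightarrow> 0) (at \<tau> within {0..1})) \<and>
        (AE s in lebesgue_on {0..1}.
           ((\<lambda>t. \<bar>pdt (k i) t s - pdt (k i) \<tau> s\<bar>) \<longlongrightarrow> 0) (at \<tau> within {0..1}))))"

definition assm_A3 ::
  "(nat \<Rightarrow> real \<Rightarrow> real \<Rightarrow> real) \<Rightarrow> (nat \<Rightarrow> real) \<Rightarrow> (nat \<Rightarrow> real) \<Rightarrow> (nat \<Rightarrow> real) \<Rightarrow> (nat \<Rightarrow> real) \<Rightarrow>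
   (nat \<Rightarrow> real \<Rightarrow> real) \<Rightarrow> (nat \<Rightarrow> real \<Rightarrow> real) \<Rightarrow> (nat \<Rightarrow> real) \<Rightarrow> (nat \<Rightarrow> real) \<Rightarrow> bool" where
  "assm_A3 k a b \<gamma> \<delta> \<phi> \<psi> c d \<longleftrightarrow> (\<forall>i\<in>{1,2}.
     0 \<le> a i \<and> a i < b i \<and> b i \<le> 1 \<and> 0 \<le> \<gamma> i \<and> \<gamma> i < \<delta> i \<and> \<delta> i \<le> 1 \<and>
     \<phi> i \<in> Linfty01 \<and> \<psi> i \<in> Linfty01 \<and>
     0 < c i \<and> c i \<le> 1 \<and> 0 < d i \<and> d i \<le> 1 \<and>
     (AE s in lebesgue_on {0..1}.
        (\<forall>t\<in>{0..1}. \<bar>k i t s\<bar> \<le> \<phi> i s) \<and>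
        (\<forall>t\<in>{0..1}. \<bar>pdt (k i) t s\<bar> \<le> \<psi> i s) \<and>
        (\<forall>t\<in>{a i..b i}. k i t s \<ge> c i * \<phi> i s) \<and>
        (\<forall>t\<in>{\<gamma> i..\<delta> i}. pdt (k i) t s \<ge> d i * \<psi> i s)))"

definition assm_A4 ::
  "(nat \<Rightarrow> real \<Rightarrow> real) \<Rightarrow> (nat \<Rightarrow> real) \<Rightarrow> (nat \<Rightarrow> real) \<Rightarrow> (nat \<Rightarrow> real) \<Rightarrow> (nat \<Rightarrow> real) \<Rightarrow>
   (nat \<Rightarrow> real \<Rightarrow> real) \<Rightarrow> (nat \<Rightarrow> real \<Rightarrow> real) \<Rightarrow> bool" where
  "assm_A4 g a b \<gamma> \<delta> \<phi> \<psi> \<longleftrightarrow> (\<forall>i\<in>{1,2}.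
     integrable (lebesgue_on {0..1}) (g i) \<and>
     (AE t in lebesgue_on {0..1}. 0 \<le> g i t) \<and>
     (LINT s|lebesgue_on {a i..b i}. \<phi> i s * g i s) > 0 \<and>
     (LINT s|lebesgue_on {\<gamma> i..\<delta> i}. \<psi> i s * g i s) > 0)"


text \<open>
  Functions on \<open>[0,1]\<close> are taken to be extensional, so that they are equal iff they agree on
  \<open>[0,1]\<close>; this matters for counting solutions. Maxima and minima of real-valued functions over a
  compact interval are written as suprema and infima: all functions concerned are continuous
  (under the assumptions above), so these are attained.
\<close>

definition C1_01 :: "(real \<Rightarrow> real) set" where
  "C1_01 = {w \<in> extensional {0..1}.
              (\<forall>t\<in>{0..1}. w differentiable (at t within {0..1})) \<and> continuous_on {0..1} (D01 w)}"

definition norm_C :: "(real \<Rightarrow> real) \<Rightarrow> real" where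
  "norm_C w = (SUP t\<in>{0..1}. \<bar>w t\<bar>)"

definition norm_C1 :: "(real \<Rightarrow> real) \<Rightarrow> real" where
  "norm_C1 w = max (norm_C w) (norm_C (D01 w))"

definition norm_prod :: "(real \<Rightarrow> real) \<times> (real \<Rightarrow> real) \<Rightarrow> real" where
  "norm_prod = (\<lambda>(u, v). max (norm_C1 u) (norm_C1 v))"

definition cone_comp :: "real \<Rightarrow> real \<Rightarrow> real \<Rightarrow> real \<Rightarrow> real \<Rightarrow> real \<Rightarrow> (real \<Rightarrow> real) set" where
  "cone_comp a b \<gamma> \<delta> c d =
     {w \<in> C1_01. (INF t\<in>{a..b}. w t) \<ge> c * norm_C w \<and>
                 (INF t\<in>{\<gamma>..\<delta>}. D01 w t) \<ge> d * norm_C (D01 w)}"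

definition cone_K ::
  "(nat \<Rightarrow> real) \<Rightarrow> (nat \<Rightarrow> real) \<Rightarrow> (nat \<Rightarrow> real) \<Rightarrow> (nat \<Rightarrow> real) \<Rightarrow> (nat \<Rightarrow> real) \<Rightarrow> (nat \<Rightarrow> real) \<Rightarrow>
   ((real \<Rightarrow> real) \<times> (real \<Rightarrow> real)) set" where
  "cone_K a b \<gamma> \<delta> c d =
     cone_comp (a 1) (b 1) (\<gamma> 1) (\<delta> 1) (c 1) (d 1) \<times> cone_comp (a 2) (b 2) (\<gamma> 2) (\<delta> 2) (c 2) (d 2)"

definition solves_system ::
  "(nat \<Rightarrow> real \<Rightarrow> real \<Rightarrow> real) \<Rightarrow> (nat \<Rightarrow> real \<Rightarrow> real) \<Rightarrow> (nat \<Rightarrow> real \<Rightarrow> real4 \<Rightarrow> real) \<Rightarrow>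
   (real \<Rightarrow> real) \<times> (real \<Rightarrow> real) \<Rightarrow> bool" where
  "solves_system k g f = (\<lambda>(u, v). \<forall>t\<in>{0..1}.
     u t = (LINT s|lebesgue_on {0..1}. k 1 t s * g 1 s * f 1 s (u s, D01 u s, v s, D01 v s)) \<and>
     v t = (LINT s|lebesgue_on {0..1}. k 2 t s * g 2 s * f 2 s (u s, D01 u s, v s, D01 v s)))"

definition nontrivial_solutions ::
  "(nat \<Rightarrow> real \<Rightarrow> real \<Rightarrow> real) \<Rightarrow> (nat \<Rightarrow> real \<Rightarrow> real) \<Rightarrow> (nat \<Rightarrow> real \<Rightarrow> real4 \<Rightarrow> real) \<Rightarrow>
   ((real \<Rightarrow> real) \<times> (real \<Rightarrow> real)) set \<Rightarrow> ((real \<Rightarrow> real) \<times> (real \<Rightarrow> real)) set" where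
  "nontrivial_solutions k g f K = {p \<in> K. solves_system k g f p \<and> norm_prod p \<noteq> 0}"

definition has_at_least :: "nat \<Rightarrow> 'a set \<Rightarrow> bool" where
  "has_at_least n A \<longleftrightarrow> (\<exists>S\<subseteq>A. finite S \<and> card S = n)"


definition const_m :: "(real \<Rightarrow> real \<Rightarrow> real) \<Rightarrow> (real \<Rightarrow> real) \<Rightarrow> real" where
  "const_m k g = 1 / (SUP t\<in>{0..1}. LINT s|lebesgue_on {0..1}. \<bar>k t s\<bar> * g s)"

definition const_m_star :: "(real \<Rightarrow> real \<Rightarrow> real) \<Rightarrow> (real \<Rightarrow> real) \<Rightarrow> real" where
  "const_m_star k g = 1 / (SUP t\<in>{0..1}. LINT s|lebesgue_on {0..1}. \<bar>pdt k t s\<bar> * g s)"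

definition const_M :: "(real \<Rightarrow> real \<Rightarrow> real) \<Rightarrow> (real \<Rightarrow> real) \<Rightarrow> real \<Rightarrow> real \<Rightarrow> real" where
  "const_M k g a b = 1 / (INF t\<in>{a..b}. LINT s|lebesgue_on {a..b}. k t s * g s)"

definition const_M_star :: "(real \<Rightarrow> real \<Rightarrow> real) \<Rightarrow> (real \<Rightarrow> real) \<Rightarrow> real \<Rightarrow> real \<Rightarrow> real" where
  "const_M_star k g \<gamma> \<delta> = 1 / (INF t\<in>{\<gamma>..\<delta>}. LINT s|lebesgue_on {\<gamma>..\<delta>}. pdt k t s * g s)"

text \<open>
  Taken in the extended reals: the growth bound on \<open>f\<close> holds only for almost every \<open>t\<close>, so the
  supremum over all \<open>t\<close> may be infinite.
\<close>

definition sup_ratio :: "(real \<Rightarrow> real4 \<Rightarrow> real) \<Rightarrow> real \<Rightarrow> (real \<times> real4) set \<Rightarrow> ereal" where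
  "sup_ratio f \<rho> B = (SUP (t, x)\<in>B. ereal (f t x / \<rho>))"

definition inf_ratio :: "(real \<Rightarrow> real4 \<Rightarrow> real) \<Rightarrow> real \<Rightarrow> (real \<times> real4) set \<Rightarrow> ereal" where
  "inf_ratio f \<rho> B = (INF (t, x)\<in>B. ereal (f t x / \<rho>))"

definition cond_I1 ::
  "(nat \<Rightarrow> real \<Rightarrow> real \<Rightarrow> real) \<Rightarrow> (nat \<Rightarrow> real \<Rightarrow> real) \<Rightarrow> (nat \<Rightarrow> real \<Rightarrow> real4 \<Rightarrow> real) \<Rightarrow>
   (nat \<Rightarrow> real) \<Rightarrow> bool" where
  "cond_I1 k g f \<rho> \<longleftrightarrow> (\<forall>i\<in>{1,2}.
     sup_ratio (f i) (\<rho> i)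
       ({0..1} \<times> {-\<rho> 1..\<rho> 1} \<times> {-\<rho> 1..\<rho> 1} \<times> {-\<rho> 2..\<rho> 2} \<times> {-\<rho> 2..\<rho> 2})
     < ereal (min (const_m (k i) (g i)) (const_m_star (k i) (g i))))"

definition cond_I0 ::
  "(nat \<Rightarrow> real \<Rightarrow> real \<Rightarrow> real) \<Rightarrow> (nat \<Rightarrow> real \<Rightarrow> real) \<Rightarrow> (nat \<Rightarrow> real \<Rightarrow> real4 \<Rightarrow> real) \<Rightarrow>
   (nat \<Rightarrow> real) \<Rightarrow> (nat \<Rightarrow> real) \<Rightarrow> (nat \<Rightarrow> real) \<Rightarrow> (nat \<Rightarrow> real) \<Rightarrow> (nat \<Rightarrow> real) \<Rightarrow> (nat \<Rightarrow> real) \<Rightarrow>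
   (nat \<Rightarrow> real) \<Rightarrow> bool" where
  "cond_I0 k g f a b \<gamma> \<delta> c d \<rho> \<longleftrightarrow>
     inf_ratio (f 1) (\<rho> 1)
       ({a 1..b 1} \<times> {c 1 * \<rho> 1..\<rho> 1} \<times> {-\<rho> 1..\<rho> 1} \<times> {-\<rho> 2..\<rho> 2} \<times> {-\<rho> 2..\<rho> 2})
     > ereal (const_M (k 1) (g 1) (a 1) (b 1)) \<and>
     inf_ratio (f 1) (\<rho> 1)
       ({\<gamma> 1..\<delta> 1} \<times> {-\<rho> 1..\<rho> 1} \<times> {d 1 * \<rho> 1..\<rho> 1} \<times> {-\<rho> 2..\<rho> 2} \<times> {-\<rho> 2..\<rho> 2})
     > ereal (const_M_star (k 1) (g 1) (\<gamma> 1) (\<delta> 1)) \<and>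
     inf_ratio (f 2) (\<rho> 2)
       ({a 2..b 2} \<times> {-\<rho> 1..\<rho> 1} \<times> {-\<rho> 1..\<rho> 1} \<times> {c 2 * \<rho> 2..\<rho> 2} \<times> {-\<rho> 2..\<rho> 2})
     > ereal (const_M (k 2) (g 2) (a 2) (b 2)) \<and>
     inf_ratio (f 2) (\<rho> 2)
       ({\<gamma> 2..\<delta> 2} \<times> {-\<rho> 1..\<rho> 1} \<times> {-\<rho> 1..\<rho> 1} \<times> {-\<rho> 2..\<rho> 2} \<times> {d 2 * \<rho> 2..\<rho> 2})
     > ereal (const_M_star (k 2) (g 2) (\<gamma> 2) (\<delta> 2))"

end

theory Submission
  imports Defs "HOL-Complex_Analysis.Great_Picard"
begin

text \<open>
Look for the quadruple \<open>((u, u'), (v, v'))\<close> instead of the pair \<open>(u, v)\<close>: treat the four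
entries as independent continuous functions and let \<open>T\<close> send a quadruple to the integrals of the
nonlinearities against \<open>k\<^sub>1\<close>, \<open>\<partial>k\<^sub>1/\<partial>t\<close>, \<open>k\<^sub>2\<close> and \<open>\<partial>k\<^sub>2/\<partial>t\<close>. Differentiation under the
integral sign shows that the second and the fourth entry of every value of \<open>T\<close> are the derivatives of
the first and the third, so fixed points of \<open>T\<close> are exactly what is wanted, and the whole argument can
be carried out in a space of continuous functions with the supremum norm. The cone \<open>K\<close> there
requires of each of the four entries only its lower bound on its own subinterval.

Where \<open>(I\<^sup>1)\<close> holds for \<open>(r\<^sub>1, r\<^sub>2)\<close>, the operator maps the box
\<open>\<parallel>u\<parallel>, \<parallel>u'\<parallel> \<le> r\<^sub>1, \<parallel>v\<parallel>, \<parallel>v'\<parallel> \<le> r\<^sub>2\<close> into its interior, so \<open>T x = t x\<close> with \<open>t \<ge> 1\<close> is impossible on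
its boundary (\<open>I1_boundary\<close>). Where \<open>(I\<^sup>0)\<close> holds, on the boundary of the box one entry \<open>U\<close> has norm
equal to its bound \<open>r\<close>; the cone condition keeps \<open>U\<close> large on its subinterval, there the nonlinearity
is large, and the corresponding entry of \<open>T x\<close> exceeds \<open>r \<ge> U\<close>. Hence \<open>x = T x + t e\<close> with \<open>t \<ge> 0\<close> is
impossible for a strictly positive \<open>e\<close> (\<open>I0_boundary\<close>). In the language of the fixed point index the
first box has index 1 and the second has index 0.

What matters is the ring between two consecutive boxes, and there Schauder's theorem
yields a fixed point directly. If the inner boundary is of the second kind and the outer of the
first (\<open>compression\<close>), replace \<open>T\<close> inside the inner box by a radial interpolation from
\<open>e\<close> at the origin to \<open>T\<close> on the inner boundary, and cut the result off radially at the outer box; a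
fixed point of the modified compact map must lie in the ring and be a fixed point of \<open>T\<close>. If the roles are
exchanged (\<open>expansion\<close>), a radial inversion of the ring turns the problem into
the first one. Schauder's theorem itself (\<open>schauder\<close>) is deduced from Brouwer's theorem on the cube
\<open>[0,1]\<^sup>n\<close> (\<open>brouwer_nat_cube\<close>), and compactness of \<open>T\<close> from the Arzela-Ascoli theorem (\<open>opr_compact\<close>).

A fixed point cannot lie on a boundary, so the solutions found in different rings are
different, and none of them is trivial, because each lies strictly outside some box. The theorem
counts the rings: one, two or three.
\<close>

section \<open>Brouwer's theorem on cubes\<close>

text \<open>
The dimension is a number and not a type, since Schauder's theorem needs cubes whose dimension is
the size of a finite net obtained in the middle of a proof.
\<close>

definition cube :: "nat \<Rightarrow> (nat \<Rightarrow> real) set" where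
  "cube n = {w. (\<forall>i<n. 0 \<le> w i \<and> w i \<le> 1) \<and> (\<forall>i\<ge>n. w i = 0)}"

lemma compact_cube: "compact (cube n)"
proof -
  have "cube n = PiE UNIV (\<lambda>i. if i < n then {0..1} else {0})"
    by (auto simp: cube_def PiE_iff split: if_splits)
  moreover have "compactin (product_topology (\<lambda>_. euclidean) UNIV)
      (PiE UNIV (\<lambda>i::nat. if i < n then {0..1::real} else {0}))"
    by (simp add: compactin_PiE)
  ultimately show ?thesis
    by (simp add: euclidean_product_topology)
qed

lemma tendsto_fun_iff:
  fixes z :: "nat \<Rightarrow> nat \<Rightarrow> real"
  shows "(z \<longlonglongrightarrow> x) \<longleftrightarrow> (\<forall>i. (\<lambda>m. z m i) \<longlonglongrightarrow> x i)"
  using limitin_componentwise[of "\<lambda>_::nat. euclidean :: real topology" UNIV z x sequentially]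
  by (simp add: euclidean_product_topology)

text \<open>
On the grid of mesh \<open>1/p\<close>, label coordinate \<open>i\<close> of a point by the direction in which the
map moves it. Kuhn's lemma provides a cell that carries both labels in every coordinate. A limit of
such cells as \<open>p\<close> grows exists by compactness, and there \<open>w i \<le> F w i\<close> and \<open>F w i \<le> w i\<close> hold for all \<open>i\<close>.
\<close>

theorem brouwer_nat_cube:
  fixes F :: "(nat \<Rightarrow> real) \<Rightarrow> (nat \<Rightarrow> real)"
  assumes cont: "continuous_on (cube n) F" and self: "F \<in> cube n \<rightarrow> cube n"
  shows "\<exists>w\<in>cube n. F w = w"
proof -
  define grid :: "nat \<Rightarrow> (nat \<Rightarrow> nat) \<Rightarrow> nat \<Rightarrow> real"
    where "grid p q = (\<lambda>i. if i < n then real (q i) / real p else 0)" for p q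
  \<comment> \<open>Label 1 means that \<open>F\<close> does not increase the coordinate. Points with coordinate 1 get it in any
  case, as Kuhn's lemma demands; it is true there because \<open>F\<close> maps into the cube.\<close>
  define label where
    "label p q i = (if q i = p \<or> F (grid p q) i < grid p q i then 1 else 0::nat)" for p q i
  have grid_cube: "grid p q \<in> cube n" if "0 < p" "\<forall>i<n. q i \<le> p" for p q
    using that by (auto simp: cube_def grid_def divide_simps)
  have F01: "0 \<le> F w i \<and> F w i \<le> 1" if "w \<in> cube n" "i < n" for w i
    using self that by (auto simp: cube_def Pi_iff)
  have "\<exists>q. \<forall>p. (\<forall>i<n. q p i < Suc p) \<and>
          (\<forall>i<n. \<exists>r s. (\<forall>j<n. q p j \<le> r j \<and> r j \<le> q p j + 1) \<and>
                        (\<forall>j<n. q p j \<le> s j \<and> s j \<le> q p j + 1) \<and> label (Suc p) r i \<noteq> label (Suc p) s i)"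
  proof (rule choice, rule allI)
    fix p
    have z: "\<forall>x. (\<forall>i<n. x i \<le> Suc p) \<longrightarrow> (\<forall>i<n. x i = 0 \<longrightarrow> label (Suc p) x i = 0)"
    proof (intro allI impI)
      fix x i assume x: "\<forall>i<n. x i \<le> Suc p" and i: "i < n" and "x i = 0"
      then have "grid (Suc p) x i = 0" by (simp add: grid_def)
      with F01[OF grid_cube[OF _ x] i] \<open>x i = 0\<close> show "label (Suc p) x i = 0"
        by (simp add: label_def)
    qed
    have o: "\<forall>x. (\<forall>i<n. x i \<le> Suc p) \<longrightarrow> (\<forall>i<n. x i = Suc p \<longrightarrow> label (Suc p) x i = 1)"
      and b: "\<forall>x. (\<forall>i<n. x i \<le> Suc p) \<longrightarrow> (\<forall>i<n. label (Suc p) x i = 0 \<or> label (Suc p) x i = 1)"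
      by (simp_all add: label_def)
    show "\<exists>q. (\<forall>i<n. q i < Suc p) \<and>
          (\<forall>i<n. \<exists>r s. (\<forall>j<n. q j \<le> r j \<and> r j \<le> q j + 1) \<and>
                        (\<forall>j<n. q j \<le> s j \<and> s j \<le> q j + 1) \<and> label (Suc p) r i \<noteq> label (Suc p) s i)"
      by (rule kuhn_lemma[OF zero_less_Suc b z o]) blast
  qed
  then obtain q where q0: "\<forall>p. (\<forall>i<n. q p i < Suc p) \<and>
          (\<forall>i<n. \<exists>r s. (\<forall>j<n. q p j \<le> r j \<and> r j \<le> q p j + 1) \<and>
                        (\<forall>j<n. q p j \<le> s j \<and> s j \<le> q p j + 1) \<and> label (Suc p) r i \<noteq> label (Suc p) s i)" ..
  have q: "q p i < Suc p" if "i < n" for p i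
    using q0 that by blast
  have qrs: "\<exists>r s. (\<forall>j<n. q p j \<le> r j \<and> r j \<le> q p j + 1) \<and>
       (\<forall>j<n. q p j \<le> s j \<and> s j \<le> q p j + 1) \<and> label (Suc p) r i \<noteq> label (Suc p) s i" if "i < n" for p i
    using q0 that by blast
  have "seq_compact (cube n)"
    using compact_cube compact_imp_seq_compact by blast
  moreover have "\<forall>p. grid (Suc p) (q p) \<in> cube n"
    by (intro allI grid_cube) (auto intro: less_imp_le q)
  ultimately obtain w k where w: "w \<in> cube n" and k: "strict_mono (k :: nat \<Rightarrow> nat)"
    and lim: "((\<lambda>p. grid (Suc p) (q p)) \<circ> k) \<longlonglongrightarrow> w"
    by (rule seq_compactE)
  have "F w i = w i" if i: "i < n" for i
  proof -
    \<comment> \<open>All corners of the chosen cells have the same limit as their base points.\<close>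
    have near: "(\<lambda>m. grid (Suc (k m)) (r m)) \<longlonglongrightarrow> w"
      if r: "\<And>m j. j < n \<Longrightarrow> q (k m) j \<le> r m j \<and> r m j \<le> q (k m) j + 1" for r
      unfolding tendsto_fun_iff
    proof
      fix j
      show "(\<lambda>m. grid (Suc (k m)) (r m) j) \<longlonglongrightarrow> w j"
      proof (cases "j < n")
        case True
        have a: "(\<lambda>m. grid (Suc (k m)) (q (k m)) j) \<longlonglongrightarrow> w j"
          using lim by (auto simp: tendsto_fun_iff o_def)
        have "(\<lambda>m. inverse (real (Suc (k m)))) \<longlonglongrightarrow> 0"
          using LIMSEQ_subseq_LIMSEQ[OF LIMSEQ_inverse_real_of_nat k] by (simp add: o_def)
        from tendsto_add[OF a this]
        have b: "(\<lambda>m. grid (Suc (k m)) (q (k m)) j + inverse (real (Suc (k m)))) \<longlonglongrightarrow> w j"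
          by simp
        show ?thesis
        proof (rule tendsto_sandwich[OF _ _ a b]; intro always_eventually allI)
          fix m
          show "grid (Suc (k m)) (q (k m)) j \<le> grid (Suc (k m)) (r m) j"
            using r[OF True, of m] True by (auto simp: grid_def intro!: divide_right_mono)
          have "real (r m j) \<le> real (q (k m) j) + 1" using r[OF True, of m] by linarith
          then show "grid (Suc (k m)) (r m) j \<le> grid (Suc (k m)) (q (k m)) j + inverse (real (Suc (k m)))"
            using True by (auto simp: grid_def inverse_eq_divide add_divide_distrib[symmetric] intro!: divide_right_mono)
        qed
      next
        case False
        then show ?thesis using w by (auto simp: grid_def cube_def)
      qed
    qed
    define between where
      "between m x \<longleftrightarrow> (\<forall>j<n. q (k m) j \<le> x j \<and> x j \<le> q (k m) j + 1)" for m x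
    have "\<exists>u v. between m u \<and> between m v \<and> label (Suc (k m)) u i = 0 \<and> label (Suc (k m)) v i = 1" for m
    proof -
      obtain r s where "between m r" "between m s" "label (Suc (k m)) r i \<noteq> label (Suc (k m)) s i"
        using qrs[OF i, of "k m"] unfolding between_def by blast
      moreover have "label (Suc (k m)) x i = 0 \<or> label (Suc (k m)) x i = 1" for x
        by (simp add: label_def)
      ultimately show ?thesis by metis
    qed
    then obtain u v where buv: "\<And>m. between m (u m)" "\<And>m. between m (v m)"
      and lu: "\<And>m. label (Suc (k m)) (u m) i = 0" and lv: "\<And>m. label (Suc (k m)) (v m) i = 1"
      by metis
    have u: "q (k m) j \<le> u m j \<and> u m j \<le> q (k m) j + 1"
      and v: "q (k m) j \<le> v m j \<and> v m j \<le> q (k m) j + 1" if "j < n" for m j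
      using buv that unfolding between_def by blast+
    have uc: "grid (Suc (k m)) (u m) \<in> cube n" for m
    proof (rule grid_cube)
      show "\<forall>i<n. u m i \<le> Suc (k m)"
      proof (intro allI impI)
        fix i assume "i < n"
        from u[OF this, of m] q[OF this, of "k m"] show "u m i \<le> Suc (k m)" by linarith
      qed
    qed simp
    have vc: "grid (Suc (k m)) (v m) \<in> cube n" for m
    proof (rule grid_cube)
      show "\<forall>i<n. v m i \<le> Suc (k m)"
      proof (intro allI impI)
        fix i assume "i < n"
        from v[OF this, of m] q[OF this, of "k m"] show "v m i \<le> Suc (k m)" by linarith
      qed
    qed simp
    have Flim: "(\<lambda>m. F (z m) i) \<longlonglongrightarrow> F w i" if "z \<longlonglongrightarrow> w" "\<And>m. z m \<in> cube n" for z
    proof -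
      have "(F \<circ> z) \<longlonglongrightarrow> F w"
        using cont w that unfolding continuous_on_sequentially by blast
      then show ?thesis by (auto simp: tendsto_fun_iff o_def)
    qed
    have "w i \<le> F w i"
    proof (rule LIMSEQ_le)
      show "(\<lambda>m. grid (Suc (k m)) (u m) i) \<longlonglongrightarrow> w i" using near[OF u] by (simp add: tendsto_fun_iff)
      show "(\<lambda>m. F (grid (Suc (k m)) (u m)) i) \<longlonglongrightarrow> F w i" by (rule Flim[OF near[OF u] uc])
      show "\<exists>N. \<forall>m\<ge>N. grid (Suc (k m)) (u m) i \<le> F (grid (Suc (k m)) (u m)) i"
      proof (intro exI allI impI)
        fix m
        show "grid (Suc (k m)) (u m) i \<le> F (grid (Suc (k m)) (u m)) i"
          using lu[of m] by (simp add: label_def not_less split: if_splits)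
      qed
    qed
    moreover have "F w i \<le> w i"
    proof (rule LIMSEQ_le)
      show "(\<lambda>m. grid (Suc (k m)) (v m) i) \<longlonglongrightarrow> w i" using near[OF v] by (simp add: tendsto_fun_iff)
      show "(\<lambda>m. F (grid (Suc (k m)) (v m)) i) \<longlonglongrightarrow> F w i" by (rule Flim[OF near[OF v] vc])
      have "F (grid (Suc (k m)) (v m)) i \<le> grid (Suc (k m)) (v m) i" for m
      proof (cases "v m i = Suc (k m)")
        case True
        then have "grid (Suc (k m)) (v m) i = 1" using i by (simp add: grid_def)
        then show ?thesis using F01[OF vc i, of m] by simp
      next
        case False
        then show ?thesis using lv[of m] by (simp add: label_def split: if_splits)
      qed
      then show "\<exists>N. \<forall>m\<ge>N. F (grid (Suc (k m)) (v m)) i \<le> grid (Suc (k m)) (v m) i" by blast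
    qed
    ultimately show ?thesis by simp
  qed
  moreover have "F w i = w i" if "\<not> i < n" for i
    using self w that by (auto simp: cube_def Pi_iff)
  ultimately have "F w = w" by (intro ext) blast
  with w show ?thesis by blast
qed

section \<open>Schauder's theorem\<close>

text \<open>
The classical projection argument: with a finite \<open>e\<close>-net \<open>c\<close> of \<open>C\<close> and the partition of unity \<open>wt\<close>
subordinate to the balls around it, every \<open>z \<in> C\<close> is within \<open>e\<close> of the convex combination of the net
points with weights \<open>wt i z\<close>. Following \<open>S\<close> by this projection gives a map of the weight vectors, to which
Brouwer's theorem applies.
\<close>

lemma schauder_approx:
  fixes S :: "'a::real_normed_vector \<Rightarrow> 'a"
  assumes D: "convex D" "D \<noteq> {}" and cont: "continuous_on D S"
    and im: "S ` D \<subseteq> C" and C: "compact C" "C \<subseteq> D" and e: "0 < e"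
  shows "\<exists>x\<in>D. dist x (S x) \<le> e"
proof -
  obtain N where N: "finite N" "N \<subseteq> C" "C \<subseteq> (\<Union>c\<in>N. ball c e)"
    using compactE_image[OF C(1), of C "\<lambda>c. ball c e"] e by force
  obtain c where c: "bij_betw c {..<card N} N"
    using ex_bij_betw_nat_finite[OF N(1)] by (metis atLeast0LessThan)
  define n where "n = card N"
  have cN: "c i \<in> N" if "i < n" for i
    using c that unfolding bij_betw_def n_def by blast
  have cD: "c i \<in> D" if "i < n" for i
    using cN[OF that] N(2) C(2) by blast
  have n0: "0 < n"
  proof -
    from D(2) obtain x where "x \<in> D" by blast
    then have "S x \<in> C" using im by blast
    then have "N \<noteq> {}" using N(3) by blast
    then show ?thesis using N(1) by (simp add: n_def card_gt_0_iff)
  qed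
  define m where "m i z = max 0 (e - dist (c i) z)" for i z
  define M where "M z = (\<Sum>i<n. m i z)" for z
  define wt where "wt i z = m i z / M z" for i z
  have m0: "0 \<le> m i z" for i z by (simp add: m_def)
  have Mpos: "0 < M z" if z: "z \<in> C" for z
  proof -
    from N(3) z obtain c' where c': "c' \<in> N" "z \<in> ball c' e" by blast
    then have "c' \<in> c ` {..<n}" using c by (simp add: bij_betw_def n_def)
    then obtain i where i: "i < n" "c i = c'" by auto
    then have "0 < m i z" using c' by (simp add: m_def)
    then show ?thesis unfolding M_def using i m0 by (intro sum_pos2[of _ i]) auto
  qed
  have wt0: "0 \<le> wt i z" if "z \<in> C" for i z
    using m0 Mpos[OF that] by (simp add: wt_def less_imp_le)
  have wtsum: "(\<Sum>i<n. wt i z) = 1" if "z \<in> C" for z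
  proof -
    have "(\<Sum>i<n. wt i z) = (\<Sum>i<n. m i z) / M z"
      unfolding wt_def by (rule sum_divide_distrib[symmetric])
    then have "(\<Sum>i<n. wt i z) = M z / M z" by (simp add: M_def)
    then show ?thesis using Mpos[OF that] by simp
  qed
  have wt1: "wt i z \<le> 1" if "z \<in> C" "i < n" for i z
    using member_le_sum[of i "{..<n}" "\<lambda>i. wt i z"] wtsum[OF that(1)] wt0[OF that(1)] that(2) by simp
  have wtcont: "continuous_on C (wt i)" for i
    unfolding wt_def
  proof (rule continuous_on_divide)
    show "continuous_on C (m i)" unfolding m_def[abs_def] by (intro continuous_intros)
    show "continuous_on C M" unfolding M_def[abs_def] m_def[abs_def] by (intro continuous_intros)
    show "\<forall>z\<in>C. M z \<noteq> 0" using Mpos by fastforce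
  qed
  \<comment> \<open>A retraction of the cube onto the standard simplex, so that Brouwer's theorem on the cube serves for
  the simplex: missing mass is distributed evenly, excess mass is scaled away.\<close>
  define retr where "retr w i = (w i + max 0 (1 - (\<Sum>j<n. w j)) / n) / max 1 (\<Sum>j<n. w j)"
    for w :: "nat \<Rightarrow> real" and i
  have retr0: "0 \<le> retr w i" if "w \<in> cube n" "i < n" for w i
    using that by (auto simp: retr_def cube_def intro!: divide_nonneg_nonneg add_nonneg_nonneg)
  have retrsum: "(\<Sum>i<n. retr w i) = 1" for w
  proof -
    have "(\<Sum>i<n. retr w i) = ((\<Sum>j<n. w j) + max 0 (1 - (\<Sum>j<n. w j))) / max 1 (\<Sum>j<n. w j)"
      unfolding retr_def using n0 by (simp add: sum_divide_distrib[symmetric] sum.distrib)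
    also have "\<dots> = 1" by (simp add: max_def)
    finally show ?thesis .
  qed
  have retr_id: "retr w i = w i" if "(\<Sum>j<n. w j) = 1" for w i
    using that by (simp add: retr_def)
  have coord: "continuous_on UNIV (\<lambda>w::nat \<Rightarrow> real. w i)" for i
    by (rule continuous_on_product_coordinates)
  have retrcont: "continuous_on (cube n) (\<lambda>w. retr w i)" for i
    unfolding retr_def
    by (intro continuous_intros continuous_on_subset[OF coord]) (use n0 in auto)
  define y where "y w = (\<Sum>i<n. retr w i *\<^sub>R c i)" for w
  have yD: "y w \<in> D" if "w \<in> cube n" for w
    unfolding y_def using retr0[OF that] retrsum cD
    by (intro convex_sum) (auto intro: D)
  have ycont: "continuous_on (cube n) y"
    unfolding y_def by (intro continuous_intros retrcont)
  define F where "F w i = (if i < n then wt i (S (y w)) else 0)" for w i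
  have SC: "S (y w) \<in> C" if "w \<in> cube n" for w
    using im yD[OF that] by blast
  have "continuous_on (cube n) F"
  proof (rule continuous_on_coordinatewise_then_product)
    fix i
    have "continuous_on (cube n) (\<lambda>w. wt i (S (y w)))"
    proof (rule continuous_on_compose2[OF wtcont])
      show "continuous_on (cube n) (\<lambda>w. S (y w))"
        by (rule continuous_on_compose2[OF cont ycont]) (use yD in blast)
    qed (use SC in blast)
    then show "continuous_on (cube n) (\<lambda>w. F w i)"
      unfolding F_def by (cases "i < n") simp_all
  qed
  moreover have "F \<in> cube n \<rightarrow> cube n"
    using wt0 wt1 SC by (auto simp: cube_def F_def)
  ultimately obtain w where w: "w \<in> cube n" and Fw: "F w = w"
    using brouwer_nat_cube by blast
  define z where "z = S (y w)"
  have zC: "z \<in> C" using SC[OF w] by (simp add: z_def)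
  have wi: "w i = wt i z" if "i < n" for i
    using Fw that unfolding F_def z_def by (metis (mono_tags))
  have "(\<Sum>i<n. w i) = 1" using wi wtsum[OF zC] by simp
  then have "y w = (\<Sum>i<n. wt i z *\<^sub>R c i)" by (simp add: y_def retr_id wi)
  moreover have "z = (\<Sum>i<n. wt i z *\<^sub>R z)"
    using wtsum[OF zC] by (metis scaleR_left.sum scaleR_one)
  ultimately have "y w - z = (\<Sum>i<n. wt i z *\<^sub>R (c i - z))"
    by (simp add: scaleR_diff_right sum_subtractf)
  then have "norm (y w - z) \<le> (\<Sum>i<n. norm (wt i z *\<^sub>R (c i - z)))"
    by (simp only: norm_sum)
  also have "\<dots> \<le> (\<Sum>i<n. wt i z * e)"
  proof (rule sum_mono)
    fix i
    show "norm (wt i z *\<^sub>R (c i - z)) \<le> wt i z * e"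
    proof (cases "dist (c i) z < e")
      case True
      then show ?thesis using wt0[OF zC, of i] by (simp add: dist_norm mult_left_mono)
    next
      case False
      then have "wt i z = 0" by (simp add: wt_def m_def)
      then show ?thesis by simp
    qed
  qed
  also have "\<dots> = e" using wtsum[OF zC] by (simp add: sum_distrib_right[symmetric])
  finally show ?thesis using yD[OF w] by (auto simp: z_def dist_norm)
qed

text \<open>
Compactness of \<open>C\<close> turns approximate fixed points into an exact one.
\<close>

theorem schauder:
  fixes S :: "'a::real_normed_vector \<Rightarrow> 'a"
  assumes D: "convex D" "D \<noteq> {}" and cont: "continuous_on D S"
    and im: "S ` D \<subseteq> C" and C: "compact C" "C \<subseteq> D"
  shows "\<exists>x\<in>D. S x = x"
proof -
  have "\<exists>x. \<forall>m. x m \<in> D \<and> dist (x m) (S (x m)) \<le> inverse (real (Suc m))"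
    by (rule choice) (use schauder_approx[OF assms] in \<open>auto simp: Bex_def\<close>)
  then obtain x where xD: "\<And>m. x m \<in> D" and xd: "\<And>m. dist (x m) (S (x m)) \<le> inverse (real (Suc m))"
    by blast
  have "seq_compact C" using C(1) compact_imp_seq_compact by blast
  moreover have "\<forall>m. S (x m) \<in> C" using im xD by blast
  ultimately obtain y k where y: "y \<in> C" and k: "strict_mono (k :: nat \<Rightarrow> nat)"
    and lim: "((\<lambda>m. S (x m)) \<circ> k) \<longlonglongrightarrow> y" by (rule seq_compactE)
  have "(\<lambda>m. dist (x (k m)) (S (x (k m)))) \<longlonglongrightarrow> 0"
  proof (rule tendsto_sandwich[of "\<lambda>_. 0"])
    show "(\<lambda>m. inverse (real (Suc (k m)))) \<longlonglongrightarrow> 0"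
      using LIMSEQ_subseq_LIMSEQ[OF LIMSEQ_inverse_real_of_nat k] by (simp add: o_def)
  qed (use xd in auto)
  then have xy: "(\<lambda>m. x (k m)) \<longlonglongrightarrow> y"
    using Lim_transform[of "\<lambda>m. S (x (k m))" y sequentially "\<lambda>m. x (k m)"] lim
    by (simp add: o_def dist_norm tendsto_norm_zero_iff)
  have "y \<in> D" using y C(2) by blast
  from continuous_on_tendsto_compose[OF cont xy this] xD
  have "(\<lambda>m. S (x (k m))) \<longlonglongrightarrow> S y" by simp
  moreover have "(\<lambda>m. S (x (k m))) \<longlonglongrightarrow> y" using lim by (simp add: o_def)
  ultimately have "S y = y" by (rule LIMSEQ_unique)
  then show ?thesis using y C(2) by blast
qed

section \<open>Compression and expansion of a cone\<close>

text \<open>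
A ring in the cone \<open>K\<close> between the boxes \<open>p \<le> 1\<close> (inner) and \<open>q \<le> 1\<close> (outer). The two
gauges need not be proportional, because the radii of the inner and the outer box are
chosen independently in the two components of the system; they only have to be equivalent.
\<close>

locale gauged_cone =
  fixes K :: "'a::real_normed_vector set" and e :: 'a and p q :: "'a \<Rightarrow> real" and \<kappa> :: real
  assumes scale: "0 \<le> t \<Longrightarrow> x \<in> K \<Longrightarrow> t *\<^sub>R x \<in> K"
    and add: "x \<in> K \<Longrightarrow> y \<in> K \<Longrightarrow> x + y \<in> K"
    and e: "e \<in> K" "e \<noteq> 0"
    and p_cont: "continuous_on UNIV p" and q_cont: "continuous_on UNIV q"
    and p_hom: "0 \<le> t \<Longrightarrow> p (t *\<^sub>R x) = t * p x" and q_hom: "0 \<le> t \<Longrightarrow> q (t *\<^sub>R x) = t * q x"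
    and q_sub: "q (x + y) \<le> q x + q y"
    and q_pos: "x \<noteq> 0 \<Longrightarrow> 0 < q x"
    and qp: "q x \<le> p x" and pq: "p x \<le> \<kappa> * q x"
begin

definition annulus :: "'a set" where "annulus = {x \<in> K. 1 \<le> p x \<and> q x \<le> 1}"

lemma p_pos: "x \<noteq> 0 \<Longrightarrow> 0 < p x" using q_pos qp by (metis less_le_trans)

lemma gauge_0: "p 0 = 0" "q 0 = 0" using p_hom[of 0 0] q_hom[of 0 0] by auto

lemma nonneg: "0 \<le> p x" "0 \<le> q x" using p_pos[of x] q_pos[of x] gauge_0 by (cases "x = 0"; simp)+

text \<open>
The ring problem is reduced to Schauder's theorem on the whole outer box \<open>D\<close>. The map \<open>V\<close> agrees with
\<open>T\<close> on the ring and is, on the segment from \<open>0\<close> to a point \<open>z\<close> with \<open>p z = 1\<close>, the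
interpolation \<open>\<pi> T z + (1 - \<pi>) e\<close> at the point \<open>\<pi> z\<close>. A fixed point \<open>\<pi> z\<close> of \<open>V\<close> with \<open>0 < \<pi> < 1\<close> would give
\<open>z = T z + ((1 - \<pi>) / \<pi>) e\<close>, against the inner condition, and \<open>V 0 = e \<noteq> 0\<close>. The radial
retraction \<open>R\<close> onto \<open>D\<close> brings in only points with \<open>T x = t x\<close>, \<open>t > 1\<close>, \<open>q x = 1\<close>, which the outer
condition excludes.
\<close>

lemma compression:
  assumes cont: "continuous_on annulus T" and im: "T ` annulus \<subseteq> C" and C: "compact C" "C \<subseteq> K"
    and inner: "\<And>x t. x \<in> annulus \<Longrightarrow> p x = 1 \<Longrightarrow> 0 \<le> t \<Longrightarrow> x \<noteq> T x + t *\<^sub>R e"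
    and outer: "\<And>x t. x \<in> annulus \<Longrightarrow> q x = 1 \<Longrightarrow> 1 \<le> t \<Longrightarrow> T x \<noteq> t *\<^sub>R x"
  shows "\<exists>x\<in>annulus. T x = x"
proof -
  define D where "D = {x \<in> K. q x \<le> 1}"
  \<comment> \<open>At the origin \<open>\<pi>\<close> vanishes and the factor \<open>\<pi> x\<close> in \<open>V\<close> suppresses the meaningless value of \<open>T\<close>.\<close>
  define \<pi> where "\<pi> x = min (p x) 1" for x
  define V where "V x = \<pi> x *\<^sub>R T (inverse (\<pi> x) *\<^sub>R x) + (1 - \<pi> x) *\<^sub>R e" for x
  define R where "R y = inverse (max 1 (q y)) *\<^sub>R y" for y
  define C1 where "C1 = (\<lambda>(t, z). t *\<^sub>R z + (1 - t) *\<^sub>R e) ` ({0..1} \<times> C)"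
  have \<pi>01: "0 \<le> \<pi> x" "\<pi> x \<le> 1" for x using nonneg by (auto simp: \<pi>_def)
  have \<pi>pos: "0 < \<pi> x" if "x \<noteq> 0" for x using p_pos[OF that] by (simp add: \<pi>_def)
  have \<pi>cont: "continuous_on S \<pi>" for S
    unfolding \<pi>_def by (intro continuous_intros continuous_on_subset[OF p_cont]) auto
  have push: "inverse (\<pi> x) *\<^sub>R x \<in> annulus" if x: "x \<in> D" "x \<noteq> 0" for x
  proof (cases "p x \<le> 1")
    case True
    then show ?thesis using x p_pos[OF x(2)] qp[of x]
      by (auto simp: annulus_def \<pi>_def D_def p_hom q_hom scale field_simps)
  next
    case False
    then show ?thesis using x by (auto simp: annulus_def \<pi>_def D_def)
  qed
  have "convex D"
  proof (rule convexI)
    fix x y and u v :: real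
    assume *: "x \<in> D" "y \<in> D" "0 \<le> u" "0 \<le> v" "u + v = 1"
    have "q (u *\<^sub>R x + v *\<^sub>R y) \<le> u * q x + v * q y"
      using q_sub[of "u *\<^sub>R x" "v *\<^sub>R y"] * by (simp add: q_hom)
    also have "\<dots> \<le> u * 1 + v * 1" using * by (intro add_mono mult_left_mono) (auto simp: D_def)
    finally show "u *\<^sub>R x + v *\<^sub>R y \<in> D" using * by (auto simp: D_def scale add)
  qed
  have D0: "0 \<in> D" using scale[of 0 e] e gauge_0 by (auto simp: D_def)
  have Rcont: "continuous_on S R" for S
    unfolding R_def by (intro continuous_intros continuous_on_subset[OF q_cont]) auto
  have "compact C1"
    unfolding C1_def using C(1)
    by (intro compact_continuous_image compact_Times) (auto simp: case_prod_unfold intro!: continuous_intros)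
  have C1K: "C1 \<subseteq> K"
    unfolding C1_def using C(2) e by (auto intro!: add scale)
  have comp: "compact (R ` C1)"
    by (rule compact_continuous_image[OF Rcont \<open>compact C1\<close>])
  have RD: "R y \<in> D" if "y \<in> K" for y
    using that by (auto simp: R_def D_def q_hom scale field_simps)
  have VC1: "V x \<in> C1" if x: "x \<in> D" for x
  proof (cases "x = 0")
    case True
    obtain z where "z \<in> C"
    proof -
      have "inverse (\<pi> (R e)) *\<^sub>R R e \<in> annulus"
        by (rule push) (use RD e in \<open>auto simp: R_def\<close>)
      then show ?thesis using im that by blast
    qed
    have "V x = e" using True gauge_0 by (simp add: V_def \<pi>_def)
    then show ?thesis unfolding C1_def using \<open>z \<in> C\<close> by (intro image_eqI[of _ _ "(0, z)"]) auto
  next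
    case False
    then have "T (inverse (\<pi> x) *\<^sub>R x) \<in> C" using push[OF x] im by blast
    then show ?thesis unfolding C1_def V_def
      by (intro image_eqI[of _ _ "(\<pi> x, T (inverse (\<pi> x) *\<^sub>R x))"]) (use \<pi>01 in auto)
  qed
  have Vcont: "continuous_on D V"
    unfolding continuous_on_eq_continuous_within
  proof
    fix x assume x: "x \<in> D"
    show "continuous (at x within D) V"
    proof (cases "x = 0")
      case False
      have "continuous_on (D - {0}) (\<lambda>x. inverse (\<pi> x) *\<^sub>R x)"
        by (intro continuous_intros \<pi>cont ballI less_imp_neq[OF \<pi>pos, symmetric]) simp
      then have "continuous_on (D - {0}) (\<lambda>x. T (inverse (\<pi> x) *\<^sub>R x))"
        by (rule continuous_on_compose2[OF cont]) (use push in auto)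
      then have "continuous_on (D - {0}) V"
        unfolding V_def by (intro continuous_intros \<pi>cont)
      then have "continuous (at x within (D - {0})) V"
        using x False by (simp add: continuous_on_eq_continuous_within)
      moreover have "at x within (D - {0}) = at x within D"
        by (rule at_within_nhd[of _ "- {0}"]) (use False in auto)
      ultimately show ?thesis by simp
    next
      case True
      \<comment> \<open>Near the origin only the boundedness of the values of \<open>T\<close> on the ring is used.\<close>
      obtain B where B: "\<And>z. z \<in> C \<Longrightarrow> norm z \<le> B"
        using compact_imp_bounded[OF C(1)] unfolding bounded_iff by blast
      have "((\<lambda>x. \<pi> x *\<^sub>R T (inverse (\<pi> x) *\<^sub>R x)) \<longlongrightarrow> 0) (at 0 within D)"
      proof (rule Lim_null_comparison)
        show "\<forall>\<^sub>F x in at 0 within D. norm (\<pi> x *\<^sub>R T (inverse (\<pi> x) *\<^sub>R x)) \<le> \<pi> x * B"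
          unfolding eventually_at_filter
        proof (intro always_eventually allI impI)
          fix x assume x: "x \<noteq> 0" "x \<in> D"
          then have "T (inverse (\<pi> x) *\<^sub>R x) \<in> C" using push im by blast
          from B[OF this] show "norm (\<pi> x *\<^sub>R T (inverse (\<pi> x) *\<^sub>R x)) \<le> \<pi> x * B"
            using \<pi>01 by (simp add: mult_left_mono)
        qed
        have "(\<pi> \<longlongrightarrow> \<pi> 0) (at 0 within D)"
          using \<pi>cont[of D] D0 by (simp add: continuous_on)
        then show "((\<lambda>x. \<pi> x * B) \<longlongrightarrow> 0) (at 0 within D)"
          using gauge_0 by (intro tendsto_mult_left_zero) (simp add: \<pi>_def[of 0])
      qed
      moreover have "((\<lambda>x. (1 - \<pi> x) *\<^sub>R e) \<longlongrightarrow> (1 - \<pi> 0) *\<^sub>R e) (at 0 within D)"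
        using \<pi>cont[of D] D0 by (intro tendsto_intros) (simp add: continuous_on)
      ultimately have "(V \<longlongrightarrow> 0 + (1 - \<pi> 0) *\<^sub>R e) (at 0 within D)"
        unfolding V_def by (rule tendsto_add)
      then show ?thesis using True gauge_0 by (simp add: continuous_within V_def \<pi>_def)
    qed
  qed
  have "\<exists>x\<in>D. R (V x) = x"
  proof (rule schauder[OF \<open>convex D\<close> _ _ _ comp])
    show "continuous_on D (\<lambda>x. R (V x))"
      by (rule continuous_on_compose2[OF Rcont Vcont subset_UNIV])
    show "(\<lambda>x. R (V x)) ` D \<subseteq> R ` C1" using VC1 by blast
    show "R ` C1 \<subseteq> D" using RD C1K by blast
  qed (use D0 in blast)
  then obtain x where x: "x \<in> D" and fixp: "R (V x) = x" by blast
  define \<sigma> where "\<sigma> = max 1 (q (V x))"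
  have \<sigma>: "1 \<le> \<sigma>" by (simp add: \<sigma>_def)
  have Vx: "V x = \<sigma> *\<^sub>R x"
    using fixp \<sigma> unfolding R_def \<sigma>_def[symmetric]
    by (metis (no_types, opaque_lifting) scaleR_scaleR right_inverse scaleR_one not_one_le_zero)
  have q1: "q x = 1" if "1 < \<sigma>"
  proof -
    have "q (V x) = \<sigma>" using that unfolding \<sigma>_def by (simp add: max_def split: if_splits)
    moreover have "q (V x) = \<sigma> * q x" using Vx q_hom \<sigma> by simp
    ultimately show ?thesis using \<sigma> by simp
  qed
  have x0: "x \<noteq> 0"
  proof
    assume "x = 0"
    then have "V x = e" using gauge_0 by (simp add: V_def \<pi>_def)
    with Vx \<open>x = 0\<close> e(2) show False by simp
  qed
  have "1 \<le> p x"
  proof (rule ccontr)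
    assume "\<not> 1 \<le> p x"
    then have p1: "p x < 1" by simp
    then have "\<sigma> = 1" using q1 qp[of x] \<sigma> by fastforce
    define z where "z = inverse (p x) *\<^sub>R x"
    have ppos: "0 < p x" using p_pos[OF x0] .
    have xz: "x = p x *\<^sub>R z" using ppos by (simp add: z_def)
    have zA: "z \<in> annulus" using push[OF x x0] p1 by (simp add: z_def \<pi>_def)
    have pz: "p z = 1" using ppos by (simp add: z_def p_hom)
    have "x = p x *\<^sub>R T z + (1 - p x) *\<^sub>R e"
      using Vx \<open>\<sigma> = 1\<close> p1 by (simp add: V_def \<pi>_def z_def)
    then have "inverse (p x) *\<^sub>R x = inverse (p x) *\<^sub>R (p x *\<^sub>R T z + (1 - p x) *\<^sub>R e)" by simp
    then have "z = T z + (inverse (p x) * (1 - p x)) *\<^sub>R e"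
      using ppos by (simp add: z_def[symmetric] scaleR_add_right)
    then show False
      using inner[OF zA pz, of "inverse (p x) * (1 - p x)"] ppos p1 by simp
  qed
  then have xA: "x \<in> annulus" using x by (auto simp: annulus_def D_def)
  have "\<pi> x = 1" using \<open>1 \<le> p x\<close> by (simp add: \<pi>_def)
  then have "T x = \<sigma> *\<^sub>R x" using Vx by (simp add: V_def)
  moreover have "\<sigma> = 1" using outer[OF xA q1, of \<sigma>] \<sigma> calculation by fastforce
  ultimately show ?thesis using xA by auto
qed

text \<open>
The map \<open>J x = x / (p x * q x)\<close> is an involution of the ring that preserves rays and exchanges the two
boundaries, since \<open>p (J x) = 1 / q x\<close> and \<open>q (J x) = 1 / p x\<close>. Conjugating \<open>T\<close> with it along each ray, that
is, passing to \<open>T' x = w x * T (J x)\<close> with \<open>w = p * q\<close>, keeps the form of both boundary conditions and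
exchanges their places, so \<open>compression\<close> applies to \<open>T'\<close>.
\<close>

lemma expansion:
  assumes cont: "continuous_on annulus T" and im: "T ` annulus \<subseteq> C" and C: "compact C" "C \<subseteq> K"
    and inner: "\<And>x t. x \<in> annulus \<Longrightarrow> p x = 1 \<Longrightarrow> 1 \<le> t \<Longrightarrow> T x \<noteq> t *\<^sub>R x"
    and outer: "\<And>x t. x \<in> annulus \<Longrightarrow> q x = 1 \<Longrightarrow> 0 \<le> t \<Longrightarrow> x \<noteq> T x + t *\<^sub>R e"
  shows "\<exists>x\<in>annulus. T x = x"
proof -
  define w where "w x = p x * q x" for x
  define J where "J x = inverse (w x) *\<^sub>R x" for x
  define T' where "T' x = w x *\<^sub>R T (J x)" for x
  have ann0: "x \<noteq> 0" if "x \<in> annulus" for x using that gauge_0 by (auto simp: annulus_def)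
  have wpos: "0 < w x" if "x \<in> annulus" for x
    using p_pos q_pos ann0[OF that] by (simp add: w_def)
  have wcont: "continuous_on S w" for S
    unfolding w_def by (intro continuous_intros continuous_on_subset[OF p_cont] continuous_on_subset[OF q_cont]) auto
  have pJ: "p (J x) = inverse (q x)" and qJ: "q (J x) = inverse (p x)" if "x \<in> annulus" for x
    using wpos[OF that] p_pos[OF ann0[OF that]] q_pos[OF ann0[OF that]]
    by (simp_all add: J_def p_hom q_hom) (simp_all add: w_def)
  have JA: "J x \<in> annulus" if "x \<in> annulus" for x
  proof -
    have "J x \<in> K" unfolding J_def using that wpos[OF that] by (auto intro!: scale simp: annulus_def)
    then show ?thesis
      using that pJ[OF that] qJ[OF that] q_pos[OF ann0[OF that]]
      by (simp add: annulus_def one_le_inverse inverse_le_1_iff)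
  qed
  have Jcont: "continuous_on annulus J"
    unfolding J_def by (intro continuous_intros wcont ballI less_imp_neq[OF wpos, symmetric])
  \<comment> \<open>This bound keeps the values of \<open>T'\<close> in a compact set.\<close>
  have wle: "w x \<le> \<bar>\<kappa>\<bar>" if "x \<in> annulus" for x
  proof -
    have "\<kappa> * q x \<le> \<bar>\<kappa>\<bar> * 1"
      using that nonneg[of x] by (intro mult_mono) (auto simp: annulus_def)
    then have "p x \<le> \<bar>\<kappa>\<bar> * 1" using pq[of x] by linarith
    then have "p x * q x \<le> \<bar>\<kappa>\<bar> * 1"
      using that nonneg[of x] by (intro mult_mono) (auto simp: annulus_def)
    then show ?thesis by (simp add: w_def)
  qed
  have "\<exists>x\<in>annulus. T' x = x"
  proof (rule compression)
    show "continuous_on annulus T'"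
      unfolding T'_def using JA
      by (intro continuous_intros wcont continuous_on_compose2[OF cont Jcont]) auto
    show "T' ` annulus \<subseteq> (\<lambda>(t, z). t *\<^sub>R z) ` ({0..\<bar>\<kappa>\<bar>} \<times> C)"
    proof
      fix y assume "y \<in> T' ` annulus"
      then obtain x where x: "x \<in> annulus" and y: "y = w x *\<^sub>R T (J x)" by (auto simp: T'_def)
      have "T (J x) \<in> C" using JA[OF x] im by blast
      then show "y \<in> (\<lambda>(t, z). t *\<^sub>R z) ` ({0..\<bar>\<kappa>\<bar>} \<times> C)"
        unfolding y using wpos[OF x] wle[OF x] by (intro image_eqI[of _ _ "(w x, T (J x))"]) auto
    qed
    show "compact ((\<lambda>(t, z). t *\<^sub>R z) ` ({0..\<bar>\<kappa>\<bar>} \<times> C))"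
      using C(1) by (intro compact_continuous_image compact_Times)
        (auto simp: case_prod_unfold intro!: continuous_intros)
    show "(\<lambda>(t, z). t *\<^sub>R z) ` ({0..\<bar>\<kappa>\<bar>} \<times> C) \<subseteq> K" using C(2) scale by auto
  next
    fix x and t :: real assume x: "x \<in> annulus" and px: "p x = 1" and t: "0 \<le> t"
    show "x \<noteq> T' x + t *\<^sub>R e"
    proof
      assume "x = T' x + t *\<^sub>R e"
      then have "inverse (w x) *\<^sub>R x = inverse (w x) *\<^sub>R (w x *\<^sub>R T (J x) + t *\<^sub>R e)"
        by (simp add: T'_def)
      then have "J x = T (J x) + (inverse (w x) * t) *\<^sub>R e"
        using wpos[OF x] by (simp add: J_def[symmetric] scaleR_add_right)
      with outer[OF JA[OF x], of "inverse (w x) * t"] qJ[OF x] px t wpos[OF x] show False by simp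
    qed
  next
    fix x and t :: real assume x: "x \<in> annulus" and qx: "q x = 1" and t: "1 \<le> t"
    show "T' x \<noteq> t *\<^sub>R x"
    proof
      assume "T' x = t *\<^sub>R x"
      then have "inverse (w x) *\<^sub>R (w x *\<^sub>R T (J x)) = inverse (w x) *\<^sub>R t *\<^sub>R x"
        by (simp add: T'_def)
      then have "T (J x) = t *\<^sub>R J x"
        using wpos[OF x] by (simp add: J_def mult.commute)
      with inner[OF JA[OF x] _ t] pJ[OF x] qx show False by simp
    qed
  qed
  then obtain x where x: "x \<in> annulus" and "T' x = x" by blast
  then have "inverse (w x) *\<^sub>R (w x *\<^sub>R T (J x)) = J x" by (simp add: T'_def J_def)
  then have "T (J x) = J x" using wpos[OF x] by simp
  then show ?thesis using JA[OF x] by blast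
qed

end

section \<open>Integral operators with a dominated kernel\<close>

abbreviation Leb01 :: "real measure" where "Leb01 \<equiv> lebesgue_on {0..1}"

lemma AE_Leb01_iff: "(AE s in Leb01. P s) \<longleftrightarrow> (AE s in lebesgue. s \<in> {0..1} \<longrightarrow> P s)"
  by (subst AE_restrict_space_iff) auto

lemma measurable_Leb01_iff:
  "(f :: real \<Rightarrow> real) \<in> borel_measurable Leb01 \<longleftrightarrow> (\<lambda>s. indicator {0..1} s *\<^sub>R f s) \<in> borel_measurable lebesgue"
  by (subst borel_measurable_restrict_space_iff) auto

text \<open>
Completeness of Lebesgue measure: almost everywhere convergence is enough for measurability.
\<close>

lemma borel_measurable_AE_limit_Leb01:
  fixes f :: "real \<Rightarrow> real"
  assumes F: "\<And>n. F n \<in> borel_measurable Leb01" and lim: "AE s in Leb01. (\<lambda>n. F n s) \<longlonglongrightarrow> f s"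
  shows "f \<in> borel_measurable Leb01"
  unfolding measurable_Leb01_iff
proof (rule borel_measurable_AE)
  show "(\<lambda>s. lim (\<lambda>n. indicator {0..1} s *\<^sub>R F n s)) \<in> borel_measurable lebesgue"
    using F unfolding measurable_Leb01_iff by (rule borel_measurable_lim_metric)
  show "AE s in lebesgue. lim (\<lambda>n. indicator {0..1} s *\<^sub>R F n s) = indicator {0..1} s *\<^sub>R f s"
    using lim unfolding AE_Leb01_iff
  proof eventually_elim
    case (elim s)
    then have "(\<lambda>n. indicator {0..1} s *\<^sub>R F n s) \<longlonglongrightarrow> indicator {0..1} s *\<^sub>R f s"
      by (cases "s \<in> {0..1}") auto
    then show ?case by (rule limI)
  qed
qed

lemma borel_measurable_AE_Leb01:
  fixes f :: "real \<Rightarrow> real"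
  assumes "g \<in> borel_measurable Leb01" "AE s in Leb01. g s = f s"
  shows "f \<in> borel_measurable Leb01"
  by (rule borel_measurable_AE_limit_Leb01[of "\<lambda>_. g"]) (use assms in auto)

lemma LINT_subinterval:
  fixes f :: "real \<Rightarrow> real"
  assumes "{a..b} \<subseteq> {0..1}"
  shows "(LINT s|lebesgue_on {a..b}. f s) = (LINT s|Leb01. indicator {a..b} s * f s)"
proof -
  have "(LINT s|lebesgue_on {a..b}. f s) = (LINT s|lebesgue. indicator {a..b} s *\<^sub>R f s)"
    by (rule integral_restrict_space) simp
  also have "\<dots> = (LINT s|lebesgue. indicator {0..1} s *\<^sub>R (indicator {a..b} s * f s))"
    by (rule Bochner_Integration.integral_cong) (use assms in \<open>auto simp: indicator_def\<close>)
  also have "\<dots> = (LINT s|Leb01. indicator {a..b} s * f s)"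
    by (rule integral_restrict_space[symmetric]) simp
  finally show ?thesis .
qed

lemma compact_closure_if_subsequences:
  fixes S :: "'a::metric_space set"
  assumes "\<And>x. (\<And>n::nat. x n \<in> S) \<Longrightarrow> \<exists>l r. strict_mono (r :: nat \<Rightarrow> nat) \<and> (x \<circ> r) \<longlonglongrightarrow> l"
  shows "compact (closure S)"
  unfolding compact_def
proof (intro allI impI)
  fix y :: "nat \<Rightarrow> 'a" assume y: "\<forall>n. y n \<in> closure S"
  have "\<forall>n. \<exists>x\<in>S. dist x (y n) < inverse (real (Suc n))"
    using y by (auto simp: closure_approachable)
  then obtain x where x: "\<And>n. x n \<in> S" "\<And>n. dist (x n) (y n) < inverse (real (Suc n))"
    by metis
  from assms[of x] x obtain l r where r: "strict_mono (r :: nat \<Rightarrow> nat)" and l: "(x \<circ> r) \<longlonglongrightarrow> l" by blast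
  have "l \<in> closure S"
    by (rule closed_sequentially[OF closed_closure _ l]) (use x(1) closure_subset in force)
  moreover have "(y \<circ> r) \<longlonglongrightarrow> l"
  proof (rule metric_LIMSEQ_I)
    fix \<epsilon> :: real assume "0 < \<epsilon>"
    then have "\<epsilon> / 2 > 0" by simp
    from metric_LIMSEQ_D[OF l this] obtain N where N: "\<And>n. n \<ge> N \<Longrightarrow> dist (x (r n)) l < \<epsilon> / 2"
      by auto
    have "(\<lambda>n. inverse (real (Suc (r n)))) \<longlonglongrightarrow> 0"
      using LIMSEQ_subseq_LIMSEQ[OF LIMSEQ_inverse_real_of_nat r] by (simp add: o_def)
    from order_tendstoD(2)[OF this \<open>\<epsilon> / 2 > 0\<close>]
    obtain M where M: "\<And>n. n \<ge> M \<Longrightarrow> inverse (real (Suc (r n))) < \<epsilon> / 2"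
      by (auto simp: eventually_sequentially)
    show "\<exists>N. \<forall>n\<ge>N. dist ((y \<circ> r) n) l < \<epsilon>"
    proof (intro exI allI impI)
      fix n assume n: "n \<ge> max N M"
      have "dist (y (r n)) l \<le> dist (x (r n)) (y (r n)) + dist (x (r n)) l" by (rule dist_triangle3)
      with x(2)[of "r n"] N[of n] M[of n] n show "dist ((y \<circ> r) n) l < \<epsilon>" by simp
    qed
  qed
  ultimately show "\<exists>l\<in>closure S. \<exists>r. strict_mono r \<and> (y \<circ> r) \<longlonglongrightarrow> l" using r by blast
qed

text \<open>
Functions on \<open>[0,1]\<close> are extended to the whole line by their boundary values, so that they live in
the Banach space of bounded continuous functions and keep their supremum norm.
\<close>

definition clip01 :: "real \<Rightarrow> real" where "clip01 t = max 0 (min 1 t)"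

lemma clip01: "clip01 t \<in> {0..1}" "t \<in> {0..1} \<Longrightarrow> clip01 t = t" "continuous_on S clip01"
  unfolding clip01_def by (auto intro!: continuous_intros)

definition ess_bounded :: "real \<Rightarrow> (real \<Rightarrow> real) set" where
  "ess_bounded H = {h \<in> borel_measurable Leb01. AE s in Leb01. \<bar>h s\<bar> \<le> H}"

lemma ess_bounded_nonneg: "h \<in> ess_bounded H \<Longrightarrow> 0 \<le> H"
proof (rule ccontr)
  assume h: "h \<in> ess_bounded H" and "\<not> 0 \<le> H"
  then have "AE s in Leb01. False" unfolding ess_bounded_def
    by (auto elim!: eventually_mono)
  then have "emeasure Leb01 (space Leb01) = 0" by (simp only: eventually_False ae_filter_eq_bot_iff)
  then show False by (simp add: emeasure_restrict_space)
qed

lemma ess_bounded_abs: "h \<in> ess_bounded H \<Longrightarrow> (\<lambda>s. \<bar>h s\<bar>) \<in> ess_bounded H"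
  by (simp add: ess_bounded_def borel_measurable_abs)

lemma integrable_mult_ess_bounded:
  assumes f: "integrable Leb01 f" and h: "h \<in> ess_bounded H"
  shows "integrable Leb01 (\<lambda>s. f s * h s)"
proof (rule Bochner_Integration.integrable_bound)
  show "integrable Leb01 (\<lambda>s. f s * H)" using f by simp
  show "(\<lambda>s. f s * h s) \<in> borel_measurable Leb01" using f h by (auto simp: ess_bounded_def)
  have "AE s in Leb01. \<bar>h s\<bar> \<le> H" using h by (simp add: ess_bounded_def)
  then show "AE s in Leb01. norm (f s * h s) \<le> norm (f s * H)"
    by eventually_elim (auto simp: abs_mult intro!: mult_left_mono)
qed

text \<open>
The exceptional null set in \<open>cont\<close> may depend on \<open>\<tau>\<close>. This is harmless: by
dominated convergence it gives continuity of \<open>t \<mapsto> \<kappa> t\<close> into \<open>L\<^sup>1\<close>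
(\<open>modulus_tendsto\<close>).
\<close>

locale integral_kernel =
  fixes \<kappa> :: "real \<Rightarrow> real \<Rightarrow> real" and \<Phi> :: "real \<Rightarrow> real"
  assumes meas: "t \<in> {0..1} \<Longrightarrow> \<kappa> t \<in> borel_measurable Leb01"
    and \<Phi>_int: "integrable Leb01 \<Phi>"
    and bound: "AE s in Leb01. \<forall>t\<in>{0..1}. \<bar>\<kappa> t s\<bar> \<le> \<Phi> s"
    and cont: "\<tau> \<in> {0..1} \<Longrightarrow> AE s in Leb01. continuous (at \<tau> within {0..1}) (\<lambda>t. \<kappa> t s)"
begin

definition val :: "(real \<Rightarrow> real) \<Rightarrow> real \<Rightarrow> real" where
  "val h t = (LINT s|Leb01. \<kappa> t s * h s)"

definition opr :: "(real \<Rightarrow> real) \<Rightarrow> real \<Rightarrow>\<^sub>C real" where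
  "opr h = Bcontfun (\<lambda>t. val h (clip01 t))"

lemma bound_at: "t \<in> {0..1} \<Longrightarrow> AE s in Leb01. \<bar>\<kappa> t s\<bar> \<le> \<Phi> s"
  using bound by eventually_elim auto

lemma integrable_kernel: "t \<in> {0..1} \<Longrightarrow> integrable Leb01 (\<kappa> t)"
proof (rule Bochner_Integration.integrable_bound[OF \<Phi>_int meas])
  assume "t \<in> {0..1}"
  from bound_at[OF this] show "AE s in Leb01. norm (\<kappa> t s) \<le> norm (\<Phi> s)"
    by eventually_elim simp
qed

lemma integrable_val: "t \<in> {0..1} \<Longrightarrow> h \<in> ess_bounded H \<Longrightarrow> integrable Leb01 (\<lambda>s. \<kappa> t s * h s)"
  by (rule integrable_mult_ess_bounded[OF integrable_kernel])

lemma modulus_tendsto: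
  assumes \<tau>: "\<tau> \<in> {0..1}"
  shows "((\<lambda>t. LINT s|Leb01. \<bar>\<kappa> t s - \<kappa> \<tau> s\<bar>) \<longlongrightarrow> 0) (at \<tau> within {0..1})"
  unfolding tendsto_at_iff_sequentially
proof (intro allI impI)
  fix x :: "nat \<Rightarrow> real" assume x: "\<forall>i. x i \<in> {0..1} - {\<tau>}" "x \<longlonglongrightarrow> \<tau>"
  have "(\<lambda>i. LINT s|Leb01. \<bar>\<kappa> (x i) s - \<kappa> \<tau> s\<bar>) \<longlonglongrightarrow> (LINT s|Leb01. 0)"
  proof (rule integral_dominated_convergence)
    show "integrable Leb01 (\<lambda>s. 2 * \<Phi> s)" using \<Phi>_int by simp
    show "(\<lambda>s. \<bar>\<kappa> (x i) s - \<kappa> \<tau> s\<bar>) \<in> borel_measurable Leb01" for i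
      using meas[OF \<tau>] meas[of "x i"] x(1) by auto
    show "AE s in Leb01. (\<lambda>i. \<bar>\<kappa> (x i) s - \<kappa> \<tau> s\<bar>) \<longlonglongrightarrow> 0"
      using cont[OF \<tau>]
    proof eventually_elim
      case (elim s)
      have "(\<lambda>i. \<kappa> (x i) s) \<longlonglongrightarrow> \<kappa> \<tau> s"
        by (rule continuous_within_tendsto_compose[OF elim _ x(2)]) (use x in auto)
      then show ?case by (metis LIM_zero tendsto_rabs_zero)
    qed
    show "AE s in Leb01. norm \<bar>\<kappa> (x i) s - \<kappa> \<tau> s\<bar> \<le> 2 * \<Phi> s" for i
      using bound
    proof eventually_elim
      case (elim s)
      then have "\<bar>\<kappa> (x i) s\<bar> \<le> \<Phi> s" "\<bar>\<kappa> \<tau> s\<bar> \<le> \<Phi> s" using \<tau> x(1) by auto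
      then show ?case by simp
    qed
  qed simp
  then show "((\<lambda>t. LINT s|Leb01. \<bar>\<kappa> t s - \<kappa> \<tau> s\<bar>) \<circ> x) \<longlonglongrightarrow> 0" by (simp add: o_def)
qed

lemma val_diff_le:
  assumes t: "t \<in> {0..1}" "\<tau> \<in> {0..1}" and h: "h \<in> ess_bounded H"
  shows "\<bar>val h t - val h \<tau>\<bar> \<le> H * (LINT s|Leb01. \<bar>\<kappa> t s - \<kappa> \<tau> s\<bar>)"
proof -
  have "val h t - val h \<tau> = (LINT s|Leb01. \<kappa> t s * h s - \<kappa> \<tau> s * h s)"
    unfolding val_def by (rule Bochner_Integration.integral_diff[symmetric]) (use integrable_val t h in auto)
  then have "\<bar>val h t - val h \<tau>\<bar> \<le> (LINT s|Leb01. \<bar>\<kappa> t s * h s - \<kappa> \<tau> s * h s\<bar>)"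
    by (simp add: integral_abs_bound)
  also have "\<dots> \<le> (LINT s|Leb01. H * \<bar>\<kappa> t s - \<kappa> \<tau> s\<bar>)"
  proof (rule integral_mono_AE)
    show "integrable Leb01 (\<lambda>s. \<bar>\<kappa> t s * h s - \<kappa> \<tau> s * h s\<bar>)"
      using integrable_val t h by (intro integrable_abs Bochner_Integration.integrable_diff) auto
    show "integrable Leb01 (\<lambda>s. H * \<bar>\<kappa> t s - \<kappa> \<tau> s\<bar>)"
      using integrable_kernel t by (intro integrable_mult_right integrable_abs Bochner_Integration.integrable_diff) auto
    have "AE s in Leb01. \<bar>h s\<bar> \<le> H" using h by (simp add: ess_bounded_def)
    then show "AE s in Leb01. \<bar>\<kappa> t s * h s - \<kappa> \<tau> s * h s\<bar> \<le> H * \<bar>\<kappa> t s - \<kappa> \<tau> s\<bar>"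
    proof eventually_elim
      case (elim s)
      have "\<kappa> t s * h s - \<kappa> \<tau> s * h s = h s * (\<kappa> t s - \<kappa> \<tau> s)" by (simp add: algebra_simps)
      then show ?case using elim by (simp add: abs_mult mult_right_mono)
    qed
  qed
  finally show ?thesis by simp
qed

text \<open>
One modulus of continuity serves all densities with the same essential bound, because
\<open>\<bar>val h t - val h \<tau>\<bar>\<close> is at most \<open>H\<close> times the \<open>L\<^sup>1\<close> distance of \<open>\<kappa> t\<close> and \<open>\<kappa> \<tau>\<close>.
\<close>

lemma equicontinuous:
  assumes \<tau>: "\<tau> \<in> {0..1}" and \<epsilon>: "0 < \<epsilon>"
  shows "\<exists>d>0. \<forall>h\<in>ess_bounded H. \<forall>t\<in>{0..1}. \<bar>\<tau> - t\<bar> < d \<longrightarrow> \<bar>val h \<tau> - val h t\<bar> < \<epsilon>"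
proof -
  define J where "J t = (LINT s|Leb01. \<bar>\<kappa> t s - \<kappa> \<tau> s\<bar>)" for t
  have "((\<lambda>t. \<bar>H\<bar> * J t) \<longlongrightarrow> \<bar>H\<bar> * 0) (at \<tau> within {0..1})"
    unfolding J_def by (intro tendsto_intros modulus_tendsto \<tau>)
  from tendstoD[OF this \<epsilon>] obtain d where d: "d > 0"
    "\<And>t. t \<in> {0..1} \<Longrightarrow> t \<noteq> \<tau> \<Longrightarrow> dist t \<tau> < d \<Longrightarrow> \<bar>\<bar>H\<bar> * J t\<bar> < \<epsilon>"
    by (auto simp: eventually_at)
  show ?thesis
  proof (intro exI conjI ballI impI)
    fix h t assume h: "h \<in> ess_bounded H" and t: "t \<in> {0..1}" "\<bar>\<tau> - t\<bar> < d"
    show "\<bar>val h \<tau> - val h t\<bar> < \<epsilon>"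
    proof (cases "t = \<tau>")
      case False
      have "\<bar>val h t - val h \<tau>\<bar> \<le> H * J t" using val_diff_le[OF t(1) \<tau> h] by (simp add: J_def)
      also have "\<dots> = \<bar>H\<bar> * J t" using ess_bounded_nonneg[OF h] by simp
      also have "\<dots> < \<epsilon>" using d(2)[OF t(1) False] t(2) by (simp add: dist_real_def abs_minus_commute)
      finally show ?thesis by (simp add: abs_minus_commute)
    qed (use \<epsilon> in simp)
  qed (use d in auto)
qed

lemma val_continuous: "h \<in> ess_bounded H \<Longrightarrow> continuous_on {0..1} (val h)"
  unfolding continuous_on_iff dist_real_def
proof (intro ballI allI impI)
  fix \<tau> \<epsilon> :: real assume h: "h \<in> ess_bounded H" and "\<tau> \<in> {0..1}" "0 < \<epsilon>"
  from equicontinuous[OF this(2,3), of H] h obtain d where "d > 0"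
    and d: "\<And>t. t \<in> {0..1} \<Longrightarrow> \<bar>\<tau> - t\<bar> < d \<Longrightarrow> \<bar>val h \<tau> - val h t\<bar> < \<epsilon>" by blast
  show "\<exists>d>0. \<forall>t\<in>{0..1}. \<bar>t - \<tau>\<bar> < d \<longrightarrow> \<bar>val h t - val h \<tau>\<bar> < \<epsilon>"
    using \<open>d > 0\<close> d by (intro exI[of _ d]) (simp add: abs_minus_commute)
qed

lemma val_abs_le:
  assumes h: "h \<in> ess_bounded H" and t: "t \<in> {0..1}"
  shows "\<bar>val h t\<bar> \<le> (LINT s|Leb01. \<Phi> s * \<bar>h s\<bar>)"
proof -
  have "\<bar>val h t\<bar> \<le> (LINT s|Leb01. \<bar>\<kappa> t s * h s\<bar>)" unfolding val_def by (rule integral_abs_bound)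
  also have "\<dots> \<le> (LINT s|Leb01. \<Phi> s * \<bar>h s\<bar>)"
  proof (rule integral_mono_AE)
    show "integrable Leb01 (\<lambda>s. \<bar>\<kappa> t s * h s\<bar>)" using integrable_val[OF t h] by simp
    have "(\<lambda>s. \<bar>h s\<bar>) \<in> ess_bounded H" using h by (rule ess_bounded_abs)
    then show "integrable Leb01 (\<lambda>s. \<Phi> s * \<bar>h s\<bar>)" by (rule integrable_mult_ess_bounded[OF \<Phi>_int])
    show "AE s in Leb01. \<bar>\<kappa> t s * h s\<bar> \<le> \<Phi> s * \<bar>h s\<bar>"
      using bound_at[OF t] by eventually_elim (auto simp: abs_mult intro!: mult_right_mono)
  qed
  finally show ?thesis .
qed

lemma opr_apply:
  assumes h: "h \<in> ess_bounded H"
  shows "opr h t = val h (clip01 t)"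
proof -
  have "(\<lambda>t. val h (clip01 t)) \<in> bcontfun"
  proof (rule bcontfun_normI)
    show "continuous_on UNIV (\<lambda>t. val h (clip01 t))"
      by (rule continuous_on_compose2[OF val_continuous[OF h] clip01(3)]) (use clip01 in auto)
    show "norm (val h (clip01 t)) \<le> (LINT s|Leb01. \<Phi> s * \<bar>h s\<bar>)" for t
      using val_abs_le[OF h clip01(1)] by simp
  qed
  then show ?thesis by (simp add: opr_def Bcontfun_inverse)
qed

lemma norm_opr_le: "h \<in> ess_bounded H \<Longrightarrow> norm (opr h) \<le> (LINT s|Leb01. \<Phi> s * \<bar>h s\<bar>)"
  by (rule norm_bound) (simp only: opr_apply real_norm_def val_abs_le[OF _ clip01(1)])

lemma opr_compact:
  obtains C where "compact C" "opr ` ess_bounded H \<subseteq> C"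
proof
  show "opr ` ess_bounded H \<subseteq> closure (opr ` ess_bounded H)" by (rule closure_subset)
  show "compact (closure (opr ` ess_bounded H))"
  proof (rule compact_closure_if_subsequences)
    fix x :: "nat \<Rightarrow> real \<Rightarrow>\<^sub>C real" assume "\<And>n. x n \<in> opr ` ess_bounded H"
    then have "\<forall>n. \<exists>h. h \<in> ess_bounded H \<and> x n = opr h" by blast
    then obtain h where h: "\<And>n. h n \<in> ess_bounded H" and x: "\<And>n. x n = opr (h n)"
      by metis
    have "\<bar>val (h n) t\<bar> \<le> (LINT s|Leb01. \<Phi> s * H)" if t: "t \<in> {0..1}" for n t
    proof -
      have "(LINT s|Leb01. \<Phi> s * \<bar>h n s\<bar>) \<le> (LINT s|Leb01. \<Phi> s * H)"
      proof (rule integral_mono_AE)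
        have "(\<lambda>s. \<bar>h n s\<bar>) \<in> ess_bounded H" using h[of n] by (rule ess_bounded_abs)
        then show "integrable Leb01 (\<lambda>s. \<Phi> s * \<bar>h n s\<bar>)" by (rule integrable_mult_ess_bounded[OF \<Phi>_int])
        show "integrable Leb01 (\<lambda>s. \<Phi> s * H)" using \<Phi>_int by simp
        have "AE s in Leb01. \<bar>h n s\<bar> \<le> H" using h by (simp add: ess_bounded_def)
        with bound_at[OF t] show "AE s in Leb01. \<Phi> s * \<bar>h n s\<bar> \<le> \<Phi> s * H"
          by eventually_elim (auto intro!: mult_left_mono)
      qed
      then show ?thesis using val_abs_le[OF h[of n] t] by linarith
    qed
    then have bd: "norm (val (h n) t) \<le> (LINT s|Leb01. \<Phi> s * H)" if "t \<in> {0..1}" for n t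
      using that by simp
    have eq: "\<exists>d. 0 < d \<and> (\<forall>n y. y \<in> {0..1} \<and> norm (t - y) < d \<longrightarrow> norm (val (h n) t - val (h n) y) < \<epsilon>)"
      if "t \<in> {0..1}" "0 < \<epsilon>" for t \<epsilon>
    proof -
      from equicontinuous[OF that, of H] obtain d where "d > 0"
        and "\<forall>h\<in>ess_bounded H. \<forall>y\<in>{0..1}. \<bar>t - y\<bar> < d \<longrightarrow> \<bar>val h t - val h y\<bar> < \<epsilon>" by blast
      then show ?thesis using h by (intro exI[of _ d]) simp
    qed
    obtain l r where r: "strict_mono (r :: nat \<Rightarrow> nat)" and lc: "continuous_on {0..1} l"
      and lim: "\<And>\<epsilon>. 0 < \<epsilon> \<Longrightarrow> \<exists>N. \<forall>n t. n \<ge> N \<and> t \<in> {0..1} \<longrightarrow> norm (val (h (r n)) t - l t) < \<epsilon>"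
      by (rule Arzela_Ascoli[of "{0..1}" "\<lambda>n. val (h n)", OF compact_Icc bd eq]) (assumption | rule that)+
    have "uniform_limit UNIV (\<lambda>n t. (x \<circ> r) n t) (\<lambda>t. l (clip01 t)) sequentially"
    proof (rule uniform_limitI)
      fix \<epsilon> :: real assume "0 < \<epsilon>"
      from lim[OF this] obtain N where
        N: "\<And>n t. n \<ge> N \<Longrightarrow> t \<in> {0..1} \<Longrightarrow> norm (val (h (r n)) t - l t) < \<epsilon>" by blast
      show "\<forall>\<^sub>F n in sequentially. \<forall>t\<in>UNIV. dist ((x \<circ> r) n t) (l (clip01 t)) < \<epsilon>"
        unfolding eventually_sequentially
        using N clip01(1) by (intro exI[of _ N]) (auto simp: x opr_apply[OF h] dist_norm)
    qed
    from uniform_limit_bcontfunE[OF this sequentially_bot]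
    obtain l' where "(x \<circ> r) \<longlonglongrightarrow> l'" by metis
    with r show "\<exists>l r. strict_mono (r :: nat \<Rightarrow> nat) \<and> (x \<circ> r) \<longlonglongrightarrow> l" by blast
  qed
qed

lemma dist_opr_le:
  assumes h: "h \<in> ess_bounded H" "h' \<in> ess_bounded H"
  shows "dist (opr h) (opr h') \<le> (LINT s|Leb01. \<Phi> s * \<bar>h s - h' s\<bar>)"
proof (rule dist_bound)
  fix t
  let ?t = "clip01 t"
  have t: "?t \<in> {0..1}" by (rule clip01)
  have d: "(\<lambda>s. h s - h' s) \<in> ess_bounded (2 * H)"
  proof -
    have "AE s in Leb01. \<bar>h s\<bar> \<le> H" "AE s in Leb01. \<bar>h' s\<bar> \<le> H" using h by (auto simp: ess_bounded_def)
    then have "AE s in Leb01. \<bar>h s - h' s\<bar> \<le> 2 * H" by eventually_elim linarith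
    then show ?thesis using h by (auto simp: ess_bounded_def)
  qed
  have "val h ?t - val h' ?t = (LINT s|Leb01. \<kappa> ?t s * h s - \<kappa> ?t s * h' s)"
    unfolding val_def by (rule Bochner_Integration.integral_diff[symmetric]) (use integrable_val t h in auto)
  also have "\<dots> = val (\<lambda>s. h s - h' s) ?t" by (simp add: val_def right_diff_distrib)
  finally show "dist (opr h t) (opr h' t) \<le> (LINT s|Leb01. \<Phi> s * \<bar>h s - h' s\<bar>)"
    using val_abs_le[OF d t] by (simp add: opr_apply[OF h(1)] opr_apply[OF h(2)] dist_real_def)
qed

text \<open>
Continuity of the operator from almost everywhere bounded convergence to uniform convergence; the
superposition operator supplies the former.
\<close>

lemma opr_tendsto:
  assumes h: "\<And>n. h n \<in> ess_bounded H" and l: "l \<in> ess_bounded H"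
    and lim: "AE s in Leb01. (\<lambda>n. h n s) \<longlonglongrightarrow> l s"
  shows "(\<lambda>n. opr (h n)) \<longlonglongrightarrow> opr l"
proof -
  have "(\<lambda>n. LINT s|Leb01. \<Phi> s * \<bar>h n s - l s\<bar>) \<longlonglongrightarrow> (LINT s|Leb01. 0)"
  proof (rule integral_dominated_convergence)
    show "integrable Leb01 (\<lambda>s. \<Phi> s * (2 * H))" using \<Phi>_int by simp
    show "(\<lambda>s. \<Phi> s * \<bar>h n s - l s\<bar>) \<in> borel_measurable Leb01" for n
      using \<Phi>_int h[of n] l by (auto simp: ess_bounded_def)
    show "AE s in Leb01. (\<lambda>n. \<Phi> s * \<bar>h n s - l s\<bar>) \<longlonglongrightarrow> 0"
      using lim
    proof eventually_elim
      case (elim s)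
      then show ?case by (intro tendsto_mult_right_zero tendsto_rabs_zero LIM_zero)
    qed
    show "AE s in Leb01. norm (\<Phi> s * \<bar>h n s - l s\<bar>) \<le> \<Phi> s * (2 * H)" for n
    proof -
      have "AE s in Leb01. \<bar>h n s\<bar> \<le> H" "AE s in Leb01. \<bar>l s\<bar> \<le> H" using h l by (auto simp: ess_bounded_def)
      with bound_at[of 0, simplified] show ?thesis
      proof eventually_elim
        case (elim s)
        then have "\<bar>h n s - l s\<bar> \<le> 2 * H" "0 \<le> \<Phi> s" by linarith+
        then show ?case by (simp add: abs_mult mult_left_mono)
      qed
    qed
  qed simp
  then have "(\<lambda>n. LINT s|Leb01. \<Phi> s * \<bar>h n s - l s\<bar>) \<longlonglongrightarrow> 0" by simp
  then have "(\<lambda>n. dist (opr (h n)) (opr l)) \<longlonglongrightarrow> 0"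
    by (rule Lim_null_comparison[rotated]) (simp add: dist_opr_le[OF h l])
  then show ?thesis by (rule tendsto_dist_iff[THEN iffD2])
qed

lemma opr_upper:
  assumes h: "h \<in> borel_measurable Leb01" and hB: "AE s in Leb01. \<bar>h s\<bar> \<le> B"
  shows "norm (opr h) \<le> B * (SUP t\<in>{0..1}. LINT s|Leb01. \<bar>\<kappa> t s\<bar>)"
proof (rule norm_bound)
  fix t
  let ?t = "clip01 t"
  have t: "?t \<in> {0..1}" by (rule clip01)
  have hb: "h \<in> ess_bounded B" using assms by (simp add: ess_bounded_def)
  have "\<bar>val h ?t\<bar> \<le> (LINT s|Leb01. \<bar>\<kappa> ?t s * h s\<bar>)" unfolding val_def by (rule integral_abs_bound)
  also have "\<dots> \<le> (LINT s|Leb01. B * \<bar>\<kappa> ?t s\<bar>)"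
  proof (rule integral_mono_AE)
    show "integrable Leb01 (\<lambda>s. \<bar>\<kappa> ?t s * h s\<bar>)" using integrable_val[OF t hb] by simp
    show "integrable Leb01 (\<lambda>s. B * \<bar>\<kappa> ?t s\<bar>)" using integrable_kernel[OF t] by simp
    show "AE s in Leb01. \<bar>\<kappa> ?t s * h s\<bar> \<le> B * \<bar>\<kappa> ?t s\<bar>"
      using hB by eventually_elim (auto simp: abs_mult mult.commute intro!: mult_right_mono)
  qed
  also have "\<dots> = B * (LINT s|Leb01. \<bar>\<kappa> ?t s\<bar>)" by simp
  also have "\<dots> \<le> B * (SUP t\<in>{0..1}. LINT s|Leb01. \<bar>\<kappa> t s\<bar>)"
  proof (rule mult_left_mono[OF cSUP_upper[OF t] ess_bounded_nonneg[OF hb]])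
    show "bdd_above ((\<lambda>t. LINT s|Leb01. \<bar>\<kappa> t s\<bar>) ` {0..1})"
    proof (rule bdd_aboveI2)
      fix t :: real assume "t \<in> {0..1}"
      then show "(LINT s|Leb01. \<bar>\<kappa> t s\<bar>) \<le> (LINT s|Leb01. \<Phi> s)"
        by (intro integral_mono_AE integrable_abs integrable_kernel bound_at \<Phi>_int)
    qed
  qed
  finally show "norm (opr h t) \<le> B * (SUP t\<in>{0..1}. LINT s|Leb01. \<bar>\<kappa> t s\<bar>)"
    by (simp add: opr_apply[OF hb])
qed

end

text \<open>
The lower bound on \<open>[a, b]\<close> is what makes the operator map into a cone on which functions are
comparable to their norm.
\<close>

locale positive_kernel = integral_kernel +
  fixes a b c :: real
  assumes ab: "0 \<le> a" "a < b" "b \<le> 1" and c: "0 < c"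
    and lower: "AE s in Leb01. \<forall>t\<in>{a..b}. c * \<Phi> s \<le> \<kappa> t s"
begin

lemma sub: "t \<in> {a..b} \<Longrightarrow> t \<in> {0..1}" using ab by auto

lemma \<Phi>_nonneg: "AE s in Leb01. 0 \<le> \<Phi> s"
  using bound_at[of 0, simplified] by eventually_elim (metis abs_ge_zero order_trans)

lemma \<kappa>_nonneg: "AE s in Leb01. \<forall>t\<in>{a..b}. 0 \<le> \<kappa> t s"
  using lower \<Phi>_nonneg
proof eventually_elim
  case (elim s)
  then have "0 \<le> c * \<Phi> s" using c by simp
  then show ?case using elim(1) order_trans by blast
qed

lemma opr_cone:
  assumes h: "h \<in> ess_bounded H" and h0: "AE s in Leb01. 0 \<le> h s" and t: "t \<in> {a..b}"
  shows "c * norm (opr h) \<le> opr h t"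
proof -
  have "c * norm (opr h) \<le> c * (LINT s|Leb01. \<Phi> s * \<bar>h s\<bar>)"
    using norm_opr_le[OF h] c by (simp add: mult_left_mono)
  also have "\<dots> = (LINT s|Leb01. c * (\<Phi> s * \<bar>h s\<bar>))" by simp
  also have "\<dots> \<le> val h t"
    unfolding val_def
  proof (rule integral_mono_AE)
    have "(\<lambda>s. \<bar>h s\<bar>) \<in> ess_bounded H" using h by (rule ess_bounded_abs)
    then show "integrable Leb01 (\<lambda>s. c * (\<Phi> s * \<bar>h s\<bar>))"
      by (intro integrable_mult_right integrable_mult_ess_bounded[OF \<Phi>_int])
    show "integrable Leb01 (\<lambda>s. \<kappa> t s * h s)" by (rule integrable_val[OF sub[OF t] h])
    show "AE s in Leb01. c * (\<Phi> s * \<bar>h s\<bar>) \<le> \<kappa> t s * h s"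
      using lower h0 by eventually_elim (use t in \<open>auto simp: mult.assoc[symmetric] intro!: mult_right_mono\<close>)
  qed
  also have "\<dots> = opr h t" using opr_apply[OF h] clip01(2)[OF sub[OF t]] by simp
  finally show ?thesis .
qed

text \<open>
Only the part of the integral over \<open>[a, b]\<close> is kept; the rest is nonnegative because \<open>\<kappa> t\<close> is
nonnegative almost everywhere on \<open>[0,1]\<close> for \<open>t \<in> [a, b]\<close>.
\<close>

lemma opr_lower:
  assumes h: "h \<in> ess_bounded H" and h0: "AE s in Leb01. 0 \<le> h s" and hB: "\<And>s. s \<in> {a..b} \<Longrightarrow> B \<le> h s"
    and B: "0 \<le> B" and t: "t \<in> {a..b}"
  shows "B * (INF t\<in>{a..b}. LINT s|lebesgue_on {a..b}. \<kappa> t s) \<le> opr h t"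
proof -
  have lint: "(LINT s|lebesgue_on {a..b}. \<kappa> t s) = (LINT s|Leb01. indicator {a..b} s * \<kappa> t s)" for t
    by (rule LINT_subinterval) (use ab in auto)
  have "bdd_below ((\<lambda>t. LINT s|lebesgue_on {a..b}. \<kappa> t s) ` {a..b})"
  proof (rule bdd_belowI2)
    fix t assume t: "t \<in> {a..b}"
    show "0 \<le> (LINT s|lebesgue_on {a..b}. \<kappa> t s)"
      unfolding lint
    proof (rule integral_nonneg_AE)
      show "AE s in Leb01. 0 \<le> indicator {a..b} s * \<kappa> t s"
        using \<kappa>_nonneg by eventually_elim (use t in \<open>auto simp: indicator_def\<close>)
    qed
  qed
  then have "B * (INF t\<in>{a..b}. LINT s|lebesgue_on {a..b}. \<kappa> t s) \<le> B * (LINT s|lebesgue_on {a..b}. \<kappa> t s)"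
    using t B by (intro mult_left_mono cINF_lower)
  also have "\<dots> = (LINT s|Leb01. B * (indicator {a..b} s * \<kappa> t s))" by (simp add: lint)
  also have "\<dots> \<le> val h t"
    unfolding val_def
  proof (rule integral_mono_AE')
    show "integrable Leb01 (\<lambda>s. \<kappa> t s * h s)" by (rule integrable_val[OF sub[OF t] h])
    show "AE s in Leb01. B * (indicator {a..b} s * \<kappa> t s) \<le> \<kappa> t s * h s"
      using \<kappa>_nonneg h0
    proof eventually_elim
      case (elim s)
      then show ?case using t hB[of s] by (auto simp: indicator_def mult.commute intro!: mult_right_mono)
    qed
    show "AE s in Leb01. 0 \<le> \<kappa> t s * h s"
      using \<kappa>_nonneg h0 by eventually_elim (use t in auto)
  qed
  also have "\<dots> = opr h t" using opr_apply[OF h] clip01(2)[OF sub[OF t]] by simp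
  finally show ?thesis .
qed

lemma INF_pos:
  assumes "0 < (LINT s|lebesgue_on {a..b}. \<Phi> s)"
  shows "0 < (INF t\<in>{a..b}. LINT s|lebesgue_on {a..b}. \<kappa> t s)"
proof -
  have sub01: "{a..b} \<subseteq> {0..1}" using ab by auto
  have intI: "integrable Leb01 (\<lambda>s. indicator {a..b} s * f s)" if "integrable Leb01 f" for f :: "real \<Rightarrow> real"
  proof (rule Bochner_Integration.integrable_bound[OF that])
    show "(\<lambda>s. indicator {a..b} s * f s) \<in> borel_measurable Leb01"
      using that ab by (intro borel_measurable_times borel_measurable_indicator) (auto simp: sets_restrict_space_iff)
  qed (auto simp: indicator_def)
  have "c * (LINT s|lebesgue_on {a..b}. \<Phi> s) \<le> (INF t\<in>{a..b}. LINT s|lebesgue_on {a..b}. \<kappa> t s)"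
  proof (rule cINF_greatest)
    fix t assume t: "t \<in> {a..b}"
    have "(LINT s|Leb01. c * (indicator {a..b} s * \<Phi> s)) \<le> (LINT s|Leb01. indicator {a..b} s * \<kappa> t s)"
    proof (rule integral_mono_AE)
      show "integrable Leb01 (\<lambda>s. c * (indicator {a..b} s * \<Phi> s))" using intI[OF \<Phi>_int] by simp
      show "integrable Leb01 (\<lambda>s. indicator {a..b} s * \<kappa> t s)" by (rule intI[OF integrable_kernel[OF sub[OF t]]])
      show "AE s in Leb01. c * (indicator {a..b} s * \<Phi> s) \<le> indicator {a..b} s * \<kappa> t s"
        using lower by eventually_elim (use t in \<open>auto simp: indicator_def\<close>)
    qed
    then show "c * (LINT s|lebesgue_on {a..b}. \<Phi> s) \<le> (LINT s|lebesgue_on {a..b}. \<kappa> t s)"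
      by (simp add: LINT_subinterval[OF sub01])
  qed (use ab in auto)
  then show ?thesis using mult_pos_pos[OF c assms] by linarith
qed

end

section \<open>Sections, superposition and differentiation of kernels\<close>

lemma AE_lebesgue_dense:
  assumes "AE t in lebesgue. t \<in> {0..1::real} \<longrightarrow> P t" and \<tau>: "\<tau> \<in> {0..1}" and \<epsilon>: "0 < \<epsilon>"
  shows "\<exists>t\<in>{0..1}. P t \<and> dist t \<tau> < \<epsilon>"
proof (rule ccontr)
  assume no: "\<not> ?thesis"
  obtain N where N: "N \<in> null_sets lebesgue" "\<And>t. t \<notin> N \<Longrightarrow> t \<in> {0..1} \<longrightarrow> P t"
    using assms(1) unfolding completion.AE_iff_null_sets by auto
  let ?I = "{max 0 (\<tau> - \<epsilon>)<..<min 1 (\<tau> + \<epsilon>)}"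
  have "?I \<subseteq> N"
  proof
    fix t assume t: "t \<in> ?I"
    then have "t \<in> {0..1}" "dist t \<tau> < \<epsilon>" by (auto simp: dist_real_def)
    with no N(2)[of t] show "t \<in> N" by blast
  qed
  then have "negligible ?I" using N(1) by (metis negligible_iff_null_sets negligible_subset)
  moreover have "?I \<noteq> {}" using \<tau> \<epsilon> by (auto simp: greaterThanLessThan_empty_iff max_def min_def)
  ultimately show False using open_not_negligible[of ?I] by simp
qed

text \<open>
Joint Lebesgue measurability makes only almost all sections measurable. Those \<open>t\<close> are dense, and every
other section is an almost everywhere limit of them.
\<close>

lemma section_measurable:
  fixes k :: "real \<Rightarrow> real \<Rightarrow> real"
  assumes k: "(\<lambda>(t, s). k t s) \<in> borel_measurable (lebesgue_on ({0..1} \<times> {0..1}))"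
    and cont: "\<And>\<tau>. \<tau> \<in> {0..1} \<Longrightarrow> AE s in Leb01. continuous (at \<tau> within {0..1}) (\<lambda>t. k t s)"
    and \<tau>: "\<tau> \<in> {0..1}"
  shows "k \<tau> \<in> borel_measurable Leb01"
proof -
  define K0 where "K0 p = indicator ({0..1} \<times> {0..1}) p *\<^sub>R k (fst p) (snd p)" for p :: "real \<times> real"
  have "{0..1::real} \<times> {0..1::real} \<in> sets lebesgue"
    by (intro sets_completionI_sets) (simp add: borel_closed closed_Times)
  then have "K0 \<in> borel_measurable lebesgue"
    using k unfolding K0_def
    by (subst (asm) borel_measurable_restrict_space_iff) (auto simp: case_prod_unfold)
  then obtain k' where k': "k' \<in> borel_measurable lborel" "AE p in lborel. K0 p = k' p"
    using completion_ex_borel_measurable_real by blast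
  have "AE p in lborel \<Otimes>\<^sub>M lborel. K0 p = k' p"
    using k'(2) unfolding lborel_prod .
  then have "AE t in lborel. AE s in lborel. K0 (t, s) = k' (t, s)"
    by (rule lborel_pair.AE_pair)
  then have "AE t in lebesgue. AE s in lebesgue. K0 (t, s) = k' (t, s)"
    by (simp add: AE_completion_iff)
  then have "AE t in lebesgue. t \<in> {0..1} \<longrightarrow> k t \<in> borel_measurable Leb01"
  proof eventually_elim
    case (elim t)
    show ?case
    proof
      assume t: "t \<in> {0..1}"
      have "k' \<in> borel_measurable borel" using k'(1) by simp
      then have "(\<lambda>s. k' (t, s)) \<in> borel_measurable lebesgue"
        by (intro measurable_completion) (simp add: measurable_compose[OF measurable_Pair1'] borel_prod[symmetric])
      moreover have "AE s in lebesgue. k' (t, s) = indicator {0..1} s *\<^sub>R k t s"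
        using elim by eventually_elim (use t in \<open>auto simp: K0_def indicator_def\<close>)
      ultimately show "k t \<in> borel_measurable Leb01"
        unfolding measurable_Leb01_iff by (rule borel_measurable_AE)
    qed
  qed
  from AE_lebesgue_dense[OF this \<tau>]
  have "\<exists>t. t \<in> {0..1} \<and> k t \<in> borel_measurable Leb01 \<and> dist t \<tau> < inverse (real (Suc n))" for n
    by (simp add: Bex_def)
  then obtain x where x: "\<And>n. x n \<in> {0..1}" "\<And>n. k (x n) \<in> borel_measurable Leb01"
    and d: "\<And>n. dist (x n) \<tau> < inverse (real (Suc n))" by metis
  have "x \<longlonglongrightarrow> \<tau>"
    unfolding tendsto_dist_iff[of x]
    by (rule Lim_null_comparison[OF _ LIMSEQ_inverse_real_of_nat]) (simp add: less_imp_le[OF d] del: of_nat_Suc)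
  show ?thesis
  proof (rule borel_measurable_AE_limit_Leb01[OF x(2)])
    show "AE s in Leb01. (\<lambda>n. k (x n) s) \<longlonglongrightarrow> k \<tau> s"
      using cont[OF \<tau>]
    proof eventually_elim
      case (elim s)
      then show ?case by (rule continuous_within_tendsto_compose[OF _ _ \<open>x \<longlonglongrightarrow> \<tau>\<close>]) (use x in auto)
    qed
  qed
qed

lemma D01_derivative:
  assumes "w differentiable (at t within {0..1})"
  shows "(w has_real_derivative D01 w t) (at t within {0..1})"
  using assms unfolding D01_def has_real_derivative_iff_has_vector_derivative
  by (simp add: vector_derivative_works)

lemma D01_eqI:
  assumes "(w has_real_derivative w') (at t within {0..1})" "t \<in> {0..1}"
  shows "D01 w t = w'"
  unfolding D01_def
  by (rule vector_derivative_within) (use assms in \<open>auto simp: has_real_derivative_iff_has_vector_derivative trivial_limit_within\<close>)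

lemma difference_quotient_tendsto:
  assumes "(w has_real_derivative w') (at \<tau> within {0..1})"
    and "\<And>n. x n \<in> {0..1} - {\<tau>}" "x \<longlonglongrightarrow> \<tau>"
  shows "(\<lambda>n. (w (x n) - w \<tau>) / (x n - \<tau>)) \<longlonglongrightarrow> w'"
  using assms unfolding has_field_derivative_iff tendsto_at_iff_sequentially o_def by blast

lemma pdt_measurable:
  assumes meas: "\<And>t. t \<in> {0..1} \<Longrightarrow> k t \<in> borel_measurable Leb01"
    and diff: "AE s in Leb01. \<forall>t\<in>{0..1}. (\<lambda>x. k x s) differentiable (at t within {0..1})"
    and \<tau>: "\<tau> \<in> {0..1}"
  shows "pdt k \<tau> \<in> borel_measurable Leb01"
proof -
  have "\<tau> islimpt {0..1}" using \<tau> by simp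
  then obtain x where x: "\<And>n. x n \<in> {0..1} - {\<tau>}" "x \<longlonglongrightarrow> \<tau>" unfolding islimpt_sequential by blast
  show ?thesis
  proof (rule borel_measurable_AE_limit_Leb01)
    show "(\<lambda>s. (k (x n) s - k \<tau> s) / (x n - \<tau>)) \<in> borel_measurable Leb01" for n
      using meas[of "x n"] meas[OF \<tau>] x(1)[of n] by auto
    show "AE s in Leb01. (\<lambda>n. (k (x n) s - k \<tau> s) / (x n - \<tau>)) \<longlonglongrightarrow> pdt k \<tau> s"
      using diff
    proof eventually_elim
      case (elim s)
      have "((\<lambda>x. k x s) has_real_derivative pdt k \<tau> s) (at \<tau> within {0..1})"
        unfolding pdt_def by (rule D01_derivative) (use elim \<tau> in blast)
      then show ?case by (rule difference_quotient_tendsto[OF _ x])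
    qed
  qed
qed

text \<open>
Approximate \<open>w\<close> by \<open>w (\<lfloor>n s\<rfloor> / n)\<close>, which takes countably many values, and use continuity of \<open>F s\<close>.
\<close>

lemma superposition_measurable:
  fixes F :: "real \<Rightarrow> 'a::topological_space \<Rightarrow> real" and w :: "real \<Rightarrow> 'a"
  assumes meas: "\<And>x. (\<lambda>s. F s x) \<in> borel_measurable Leb01"
    and cont: "AE s in Leb01. continuous_on UNIV (F s)"
    and w: "continuous_on UNIV w"
  shows "(\<lambda>s. F s (w s)) \<in> borel_measurable Leb01"
proof (rule borel_measurable_AE_limit_Leb01)
  let ?x = "\<lambda>n s. real_of_int \<lfloor>real (Suc n) * s\<rfloor> / real (Suc n)"
  show "(\<lambda>s. F s (w (?x n s))) \<in> borel_measurable Leb01" for n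
  proof (rule measurable_compose_countable[where f = "\<lambda>j s. F s (w (real_of_int j / real (Suc n)))" and g = "\<lambda>s. \<lfloor>real (Suc n) * s\<rfloor>"])
    have "(\<lambda>s::real. s) \<in> borel_measurable Leb01"
      by (intro measurable_restrict_space1 measurable_completion) simp
    then have "(\<lambda>s::real. real (Suc n) * s) \<in> borel_measurable Leb01"
      by (rule borel_measurable_times[OF borel_measurable_const])
    then show "(\<lambda>s. \<lfloor>real (Suc n) * s\<rfloor>) \<in> measurable Leb01 (count_space UNIV)"
      by (rule measurable_compose[OF _ measurable_real_floor])
  qed (rule meas)
  show "AE s in Leb01. (\<lambda>n. F s (w (?x n s))) \<longlonglongrightarrow> F s (w s)"
    using cont
  proof eventually_elim
    case (elim s)
    have "(\<lambda>n. ?x n s) \<longlonglongrightarrow> s"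
    proof -
      have "\<bar>?x n s - s\<bar> \<le> inverse (real (Suc n))" for n
      proof -
        have "\<bar>real_of_int \<lfloor>real (Suc n) * s\<rfloor> - real (Suc n) * s\<bar> \<le> 1" by linarith
        moreover have "?x n s - s = (real_of_int \<lfloor>real (Suc n) * s\<rfloor> - real (Suc n) * s) / real (Suc n)"
          by (simp add: field_simps)
        ultimately show ?thesis by (simp add: abs_divide inverse_eq_divide divide_right_mono)
      qed
      then have "(\<lambda>n. ?x n s - s) \<longlonglongrightarrow> 0"
        by (intro Lim_null_comparison[OF _ LIMSEQ_inverse_real_of_nat]) auto
      then show ?thesis by (simp only: LIM_zero_iff)
    qed
    then have "(\<lambda>n. w (?x n s)) \<longlonglongrightarrow> w s"
      by (rule continuous_on_tendsto_compose[OF w]) auto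
    then show ?case by (rule continuous_on_tendsto_compose[OF elim]) auto
  qed
qed

text \<open>
Dominated convergence of the difference quotients; the mean value inequality bounds them by
\<open>\<Psi> s\<close>, uniformly in the increment.
\<close>

lemma val_has_derivative:
  assumes "integral_kernel \<kappa> \<Phi>" "integral_kernel \<kappa>' \<Psi>"
    and deriv: "AE s in Leb01. \<forall>t\<in>{0..1}. ((\<lambda>x. \<kappa> x s) has_real_derivative \<kappa>' t s) (at t within {0..1})"
    and h: "h \<in> ess_bounded H" and \<tau>: "\<tau> \<in> {0..1}"
  shows "(integral_kernel.val \<kappa> h has_real_derivative integral_kernel.val \<kappa>' h \<tau>) (at \<tau> within {0..1})"
proof -
  interpret u: integral_kernel \<kappa> \<Phi> by fact
  interpret v: integral_kernel \<kappa>' \<Psi> by fact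
  show ?thesis
    unfolding has_field_derivative_iff tendsto_at_iff_sequentially o_def
  proof (intro allI impI)
    fix x :: "nat \<Rightarrow> real" assume x: "\<forall>n. x n \<in> {0..1} - {\<tau>}" and lim: "x \<longlonglongrightarrow> \<tau>"
    have x1: "x n \<in> {0..1}" "x n - \<tau> \<noteq> 0" for n using x by auto
    have "(\<lambda>n. LINT s|Leb01. (\<kappa> (x n) s - \<kappa> \<tau> s) / (x n - \<tau>) * h s) \<longlonglongrightarrow> (LINT s|Leb01. \<kappa>' \<tau> s * h s)"
    proof (rule integral_dominated_convergence)
      show "integrable Leb01 (\<lambda>s. \<Psi> s * \<bar>h s\<bar>)"
        by (rule integrable_mult_ess_bounded[OF v.\<Phi>_int ess_bounded_abs[OF h]])
      show "(\<lambda>s. \<kappa>' \<tau> s * h s) \<in> borel_measurable Leb01"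
        using v.integrable_val[OF \<tau> h] by simp
      show "(\<lambda>s. (\<kappa> (x n) s - \<kappa> \<tau> s) / (x n - \<tau>) * h s) \<in> borel_measurable Leb01" for n
        by (intro borel_measurable_times borel_measurable_divide borel_measurable_diff borel_measurable_const
            u.meas \<tau> x1(1)) (use h in \<open>simp add: ess_bounded_def\<close>)
      show "AE s in Leb01. (\<lambda>n. (\<kappa> (x n) s - \<kappa> \<tau> s) / (x n - \<tau>) * h s) \<longlonglongrightarrow> \<kappa>' \<tau> s * h s"
        using deriv
      proof eventually_elim
        case (elim s)
        show ?case
          by (intro tendsto_mult_right difference_quotient_tendsto[OF _ _ lim]) (use elim \<tau> x in auto)
      qed
      show "AE s in Leb01. norm ((\<kappa> (x n) s - \<kappa> \<tau> s) / (x n - \<tau>) * h s) \<le> \<Psi> s * \<bar>h s\<bar>" for n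
        using deriv v.bound
      proof eventually_elim
        case (elim s)
        have "norm (\<kappa> (x n) s - \<kappa> \<tau> s) \<le> \<Psi> s * norm (x n - \<tau>)"
          by (rule field_differentiable_bound[of "{0..1}" "\<lambda>x. \<kappa> x s" "\<lambda>t. \<kappa>' t s"])
            (use elim \<tau> x1 in auto)
        then have "\<bar>(\<kappa> (x n) s - \<kappa> \<tau> s) / (x n - \<tau>)\<bar> \<le> \<Psi> s"
          using x1(2)[of n] by (simp add: abs_divide divide_le_eq)
        then show ?case unfolding real_norm_def abs_mult by (rule mult_right_mono) simp
      qed
    qed
    moreover have "(LINT s|Leb01. (\<kappa> (x n) s - \<kappa> \<tau> s) / (x n - \<tau>) * h s)
        = (u.val h (x n) - u.val h \<tau>) / (x n - \<tau>)" for n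
    proof -
      have "(LINT s|Leb01. (\<kappa> (x n) s - \<kappa> \<tau> s) / (x n - \<tau>) * h s)
          = (LINT s|Leb01. (\<kappa> (x n) s * h s - \<kappa> \<tau> s * h s) / (x n - \<tau>))"
        by (rule Bochner_Integration.integral_cong) (simp_all add: left_diff_distrib)
      also have "\<dots> = (LINT s|Leb01. \<kappa> (x n) s * h s - \<kappa> \<tau> s * h s) / (x n - \<tau>)" by simp
      also have "\<dots> = (u.val h (x n) - u.val h \<tau>) / (x n - \<tau>)"
        unfolding u.val_def
        by (subst Bochner_Integration.integral_diff[OF u.integrable_val[OF x1(1) h] u.integrable_val[OF \<tau> h]]) simp
      finally show ?thesis .
    qed
    ultimately show "(\<lambda>n. (u.val h (x n) - u.val h \<tau>) / (x n - \<tau>)) \<longlonglongrightarrow> v.val h \<tau>"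
      by (simp only: v.val_def)
  qed
qed

lemma Linfty01_ess_bounded:
  assumes "\<phi> \<in> Linfty01" obtains C where "\<phi> \<in> ess_bounded C"
  using assms by (auto simp: Linfty01_def ess_bounded_def)

lemma weighted_integral_kernel:
  assumes meas: "\<And>t. t \<in> {0..1} \<Longrightarrow> \<kappa> t \<in> borel_measurable Leb01"
    and cont: "\<And>\<tau>. \<tau> \<in> {0..1} \<Longrightarrow> AE s in Leb01. continuous (at \<tau> within {0..1}) (\<lambda>t. \<kappa> t s)"
    and bound: "AE s in Leb01. \<forall>t\<in>{0..1}. \<bar>\<kappa> t s\<bar> \<le> \<phi> s"
    and \<phi>: "\<phi> \<in> Linfty01" and g: "integrable Leb01 g" "AE s in Leb01. 0 \<le> g s"
  shows "integral_kernel (\<lambda>t s. \<kappa> t s * g s) (\<lambda>s. \<phi> s * g s)"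
proof
  show "(\<lambda>s. \<kappa> t s * g s) \<in> borel_measurable Leb01" if "t \<in> {0..1}" for t
    using meas[OF that] g(1) by auto
  obtain C where "\<phi> \<in> ess_bounded C" using \<phi> by (rule Linfty01_ess_bounded)
  from integrable_mult_ess_bounded[OF g(1) this] show "integrable Leb01 (\<lambda>s. \<phi> s * g s)"
    by (simp add: mult.commute)
  show "AE s in Leb01. \<forall>t\<in>{0..1}. \<bar>\<kappa> t s * g s\<bar> \<le> \<phi> s * g s"
    using bound g(2) by eventually_elim (auto simp: abs_mult intro!: mult_right_mono)
  show "AE s in Leb01. continuous (at \<tau> within {0..1}) (\<lambda>t. \<kappa> t s * g s)" if "\<tau> \<in> {0..1}" for \<tau>
    using cont[OF that] by eventually_elim (intro continuous_intros)
qed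

section \<open>A single equation\<close>

text \<open>
The hypotheses on one of the two equations. Both the kernel and its derivative in \<open>t\<close>, weighted by
\<open>g\<close>, are positive kernels in the sense above, on their own subintervals.
\<close>

locale hammerstein_kernel =
  fixes k :: "real \<Rightarrow> real \<Rightarrow> real" and g \<phi> \<psi> :: "real \<Rightarrow> real" and a b c \<gamma> \<delta> d :: real
  assumes k_meas: "(\<lambda>(t, s). k t s) \<in> borel_measurable (lebesgue_on ({0..1} \<times> {0..1}))"
    and k_diff: "AE s in Leb01. \<forall>t\<in>{0..1}. (\<lambda>x. k x s) differentiable (at t within {0..1})"
    and k_lim: "\<tau> \<in> {0..1} \<Longrightarrow> AE s in Leb01. ((\<lambda>t. \<bar>k t s - k \<tau> s\<bar>) \<longlongrightarrow> 0) (at \<tau> within {0..1})"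
    and pdt_lim: "\<tau> \<in> {0..1} \<Longrightarrow> AE s in Leb01. ((\<lambda>t. \<bar>pdt k t s - pdt k \<tau> s\<bar>) \<longlongrightarrow> 0) (at \<tau> within {0..1})"
    and ab: "0 \<le> a" "a < b" "b \<le> 1" and \<gamma>\<delta>: "0 \<le> \<gamma>" "\<gamma> < \<delta>" "\<delta> \<le> 1"
    and \<phi>: "\<phi> \<in> Linfty01" and \<psi>: "\<psi> \<in> Linfty01"
    and c: "0 < c" "c \<le> 1" and d: "0 < d" "d \<le> 1"
    and bounds: "AE s in Leb01.
        (\<forall>t\<in>{0..1}. \<bar>k t s\<bar> \<le> \<phi> s) \<and> (\<forall>t\<in>{0..1}. \<bar>pdt k t s\<bar> \<le> \<psi> s) \<and>
        (\<forall>t\<in>{a..b}. k t s \<ge> c * \<phi> s) \<and> (\<forall>t\<in>{\<gamma>..\<delta>}. pdt k t s \<ge> d * \<psi> s)"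
    and g_int: "integrable Leb01 g" and g_nonneg: "AE s in Leb01. 0 \<le> g s"
    and \<phi>g: "0 < (LINT s|lebesgue_on {a..b}. \<phi> s * g s)"
    and \<psi>g: "0 < (LINT s|lebesgue_on {\<gamma>..\<delta>}. \<psi> s * g s)"
begin

lemma k_cont:
  assumes "\<tau> \<in> {0..1}" shows "AE s in Leb01. continuous (at \<tau> within {0..1}) (\<lambda>t. k t s)"
  using k_lim[OF assms] by (simp add: continuous_within tendsto_rabs_zero_iff LIM_zero_iff)

lemma pdt_cont:
  assumes "\<tau> \<in> {0..1}" shows "AE s in Leb01. continuous (at \<tau> within {0..1}) (\<lambda>t. pdt k t s)"
  using pdt_lim[OF assms] by (simp add: continuous_within tendsto_rabs_zero_iff LIM_zero_iff)

sublocale u: positive_kernel "\<lambda>t s. k t s * g s" "\<lambda>s. \<phi> s * g s" a b c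
proof -
  interpret integral_kernel "\<lambda>t s. k t s * g s" "\<lambda>s. \<phi> s * g s"
    by (rule weighted_integral_kernel[OF section_measurable[OF k_meas k_cont] k_cont _ \<phi> g_int g_nonneg])
      (use bounds in auto)
  show "positive_kernel (\<lambda>t s. k t s * g s) (\<lambda>s. \<phi> s * g s) a b c"
  proof (unfold_locales, goal_cases)
    case 5
    show ?case using bounds g_nonneg
      by eventually_elim (auto simp: mult.assoc[symmetric] intro!: mult_right_mono)
  qed (use ab c in auto)
qed

sublocale du: positive_kernel "\<lambda>t s. pdt k t s * g s" "\<lambda>s. \<psi> s * g s" \<gamma> \<delta> d
proof -
  interpret integral_kernel "\<lambda>t s. pdt k t s * g s" "\<lambda>s. \<psi> s * g s"
    by (rule weighted_integral_kernel[OF pdt_measurable[OF section_measurable[OF k_meas k_cont] k_diff] pdt_cont _ \<psi> g_int g_nonneg])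
      (use bounds in auto)
  show "positive_kernel (\<lambda>t s. pdt k t s * g s) (\<lambda>s. \<psi> s * g s) \<gamma> \<delta> d"
  proof (unfold_locales, goal_cases)
    case 5
    show ?case using bounds g_nonneg
      by eventually_elim (auto simp: mult.assoc[symmetric] intro!: mult_right_mono)
  qed (use \<gamma>\<delta> d in auto)
qed

lemma val_derivative:
  assumes "h \<in> ess_bounded H" "t \<in> {0..1}"
  shows "(u.val h has_real_derivative du.val h t) (at t within {0..1})"
proof (rule val_has_derivative[OF u.integral_kernel_axioms du.integral_kernel_axioms _ assms])
  show "AE s in Leb01. \<forall>t\<in>{0..1}. ((\<lambda>x. k x s * g s) has_real_derivative pdt k t s * g s) (at t within {0..1})"
    using k_diff
  proof eventually_elim
    case (elim s)
    show ?case
    proof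
      fix t :: real assume "t \<in> {0..1}"
      then have "((\<lambda>x. k x s) has_real_derivative pdt k t s) (at t within {0..1})"
        unfolding pdt_def using elim D01_derivative by blast
      then show "((\<lambda>x. k x s * g s) has_real_derivative pdt k t s * g s) (at t within {0..1})"
        by (rule DERIV_cmult_right)
    qed
  qed
qed

lemma abs_weight:
  assumes "t \<in> {0..1}"
  shows "(LINT s|Leb01. \<bar>k t s * g s\<bar>) = (LINT s|Leb01. \<bar>k t s\<bar> * g s)"
    and "(LINT s|Leb01. \<bar>pdt k t s * g s\<bar>) = (LINT s|Leb01. \<bar>pdt k t s\<bar> * g s)"
proof -
  have *: "AE s in Leb01. \<bar>x s * g s\<bar> = \<bar>x s\<bar> * g s" for x
    using g_nonneg by eventually_elim (simp add: abs_mult)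
  have m: "(\<lambda>s. \<bar>x s\<bar> * g s) \<in> borel_measurable Leb01"
    if "(\<lambda>s. x s * g s) \<in> borel_measurable Leb01" for x
    by (rule borel_measurable_AE_Leb01[OF borel_measurable_abs[OF that] *])
  show "(LINT s|Leb01. \<bar>k t s * g s\<bar>) = (LINT s|Leb01. \<bar>k t s\<bar> * g s)"
    by (rule integral_cong_AE[OF borel_measurable_abs[OF u.meas[OF assms]] m[OF u.meas[OF assms]] *])
  show "(LINT s|Leb01. \<bar>pdt k t s * g s\<bar>) = (LINT s|Leb01. \<bar>pdt k t s\<bar> * g s)"
    by (rule integral_cong_AE[OF borel_measurable_abs[OF du.meas[OF assms]] m[OF du.meas[OF assms]] *])
qed

text \<open>
With \<open>S\<close> the supremum that defines \<open>const_m\<close> or \<open>const_m_star\<close>, the inequality \<open>0 \<le> M < 1 / S\<close> forces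
\<open>S > 0\<close>, hence \<open>M * S < 1\<close>, while \<open>\<rho> * M * S\<close> bounds the norm of the image.
\<close>

lemma norm_less_if_below_m:
  assumes h: "h \<in> borel_measurable Leb01" and h0: "\<And>s. s \<in> {0..1} \<Longrightarrow> 0 \<le> h s"
    and hB: "\<And>s. s \<in> {0..1} \<Longrightarrow> h s \<le> \<rho> * M" and \<rho>: "0 < \<rho>"
    and M: "M < min (const_m k g) (const_m_star k g)"
  shows "norm (u.opr h) < \<rho>" "norm (du.opr h) < \<rho>"
proof -
  have "0 \<le> \<rho> * M" using order_trans[OF h0[of 0] hB[of 0]] by simp
  then have M0: "0 \<le> M" using \<rho> by (simp add: zero_le_mult_iff)
  have AEh: "AE s in Leb01. \<bar>h s\<bar> \<le> \<rho> * M" using h0 hB by (intro AE_I2) auto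
  have less: "\<rho> * M * S < \<rho>" if "M < 1 / S" for S
  proof -
    have "0 < 1 / S" using that M0 by linarith
    then have "0 < S" by simp
    then have "M * S < 1" using that by (simp add: less_divide_eq)
    then have "\<rho> * (M * S) < \<rho> * 1" using \<rho> by (rule mult_strict_left_mono)
    then show ?thesis by (simp add: mult.assoc)
  qed
  have "norm (u.opr h) \<le> \<rho> * M * (SUP t\<in>{0..1}. LINT s|Leb01. \<bar>k t s\<bar> * g s)"
    using u.opr_upper[OF h AEh] by (simp only: SUP_cong[OF refl abs_weight(1)])
  also have "\<dots> < \<rho>" by (rule less) (use M in \<open>simp add: const_m_def\<close>)
  finally show "norm (u.opr h) < \<rho>" .
  have "norm (du.opr h) \<le> \<rho> * M * (SUP t\<in>{0..1}. LINT s|Leb01. \<bar>pdt k t s\<bar> * g s)"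
    using du.opr_upper[OF h AEh] by (simp only: SUP_cong[OF refl abs_weight(2)])
  also have "\<dots> < \<rho>" by (rule less) (use M in \<open>simp add: const_m_star_def\<close>)
  finally show "norm (du.opr h) < \<rho>" .
qed

text \<open>
The assumption on \<open>\<phi> g\<close> makes the minimum in \<open>const_M\<close> positive, so that \<open>const_M k g a b < L\<close> says that \<open>L\<close> times this minimum exceeds 1.
\<close>

lemma opr_greater_if_above_M:
  assumes h: "h \<in> ess_bounded H" and h0: "\<And>s. s \<in> {0..1} \<Longrightarrow> 0 \<le> h s"
    and hB: "\<And>s. s \<in> {a..b} \<Longrightarrow> \<rho> * L \<le> h s" and \<rho>: "0 < \<rho>"
    and L: "const_M k g a b < L" and t: "t \<in> {a..b}"
  shows "\<rho> < u.opr h t"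
proof -
  let ?I = "INF t\<in>{a..b}. LINT s|lebesgue_on {a..b}. k t s * g s"
  have I: "0 < ?I" by (rule u.INF_pos[OF \<phi>g])
  have L1: "1 < L * ?I" using L I by (simp add: const_M_def divide_less_eq)
  then have "0 < L * ?I" by linarith
  then have "0 < L" using I by (rule zero_less_mult_pos2)
  have "\<rho> < \<rho> * (L * ?I)" using L1 \<rho> by simp
  also have "\<dots> = \<rho> * L * ?I" by simp
  also have "\<dots> \<le> u.opr h t"
    by (rule u.opr_lower[OF h _ hB _ t]) (use h0 \<open>0 < L\<close> \<rho> in auto)
  finally show ?thesis .
qed

lemma opr_greater_if_above_M_star:
  assumes h: "h \<in> ess_bounded H" and h0: "\<And>s. s \<in> {0..1} \<Longrightarrow> 0 \<le> h s"
    and hB: "\<And>s. s \<in> {\<gamma>..\<delta>} \<Longrightarrow> \<rho> * L \<le> h s" and \<rho>: "0 < \<rho>"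
    and L: "const_M_star k g \<gamma> \<delta> < L" and t: "t \<in> {\<gamma>..\<delta>}"
  shows "\<rho> < du.opr h t"
proof -
  let ?I = "INF t\<in>{\<gamma>..\<delta>}. LINT s|lebesgue_on {\<gamma>..\<delta>}. pdt k t s * g s"
  have I: "0 < ?I" by (rule du.INF_pos[OF \<psi>g])
  have L1: "1 < L * ?I" using L I by (simp add: const_M_star_def divide_less_eq)
  then have "0 < L * ?I" by linarith
  then have "0 < L" using I by (rule zero_less_mult_pos2)
  have "\<rho> < \<rho> * (L * ?I)" using L1 \<rho> by simp
  also have "\<dots> = \<rho> * L * ?I" by simp
  also have "\<dots> \<le> du.opr h t"
    by (rule du.opr_lower[OF h _ hB _ t]) (use h0 \<open>0 < L\<close> \<rho> in auto)
  finally show ?thesis .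
qed

end

section \<open>The cone of the system\<close>

type_synonym cfun = "real \<Rightarrow>\<^sub>C real"

text \<open>
The condition on a single entry of a quadruple. It is imposed on \<open>u\<close> and on \<open>u'\<close> separately, without
asking that the one be the derivative of the other, which makes closedness and
convexity of the cone immediate.
\<close>

definition bcone :: "real \<Rightarrow> real \<Rightarrow> real \<Rightarrow> cfun set" where
  "bcone a b c = {U :: cfun. \<forall>t\<in>{a..b}. c * norm U \<le> apply_bcontfun U t}"

lemma continuous_on_eval: "continuous_on S (\<lambda>U::cfun. apply_bcontfun U t)"
  unfolding continuous_on_iff using dist_fun_lt_imp_dist_val_lt by metis

lemma closed_bcone: "closed (bcone a b c)"
proof -
  have "bcone a b c = (\<Inter>t\<in>{a..b}. {U :: cfun. c * norm U \<le> apply_bcontfun U t})" by (auto simp: bcone_def)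
  moreover have "closed {U::cfun. c * norm U \<le> apply_bcontfun U t}" for t
    by (intro closed_Collect_le continuous_intros continuous_on_eval)
  ultimately show ?thesis by auto
qed

lemma bcone_scale: "0 \<le> t \<Longrightarrow> U \<in> bcone a b c \<Longrightarrow> t *\<^sub>R U \<in> bcone a b c"
  by (auto simp: bcone_def mult.left_commute[of c] intro!: mult_left_mono)

lemma bcone_add:
  assumes "0 \<le> c" "U \<in> bcone a b c" "V \<in> bcone a b c"
  shows "U + V \<in> bcone a b c"
  unfolding bcone_def
proof (intro CollectI ballI)
  fix t assume t: "t \<in> {a..b}"
  have "c * norm (U + V) \<le> c * norm U + c * norm V"
    using norm_triangle_ineq[of U V] assms(1) by (metis distrib_left mult_left_mono)
  then show "c * norm (U + V) \<le> (U + V) t" using assms t by (force simp: bcone_def)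
qed

lemma bcone_const: "0 < c \<Longrightarrow> c \<le> 1 \<Longrightarrow> const_bcontfun 1 \<in> bcone a b c"
proof -
  assume c: "0 < c" "c \<le> 1"
  have "norm (const_bcontfun 1 :: cfun) \<le> 1" by (rule norm_bound) simp
  then have "c * norm (const_bcontfun 1 :: cfun) \<le> 1 * 1" using c by (intro mult_mono) auto
  then show ?thesis by (simp add: bcone_def)
qed

type_synonym state = "(cfun \<times> cfun) \<times> (cfun \<times> cfun)"

definition c1norm :: "cfun \<times> cfun \<Rightarrow> real" where "c1norm y = max (norm (fst y)) (norm (snd y))"

text \<open>
The gauge of the box with radii \<open>\<rho> 1\<close> and \<open>\<rho> 2\<close>.
\<close>

definition scaled_norm :: "(nat \<Rightarrow> real) \<Rightarrow> state \<Rightarrow> real" where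
  "scaled_norm \<rho> x = max (c1norm (fst x) / \<rho> 1) (c1norm (snd x) / \<rho> 2)"

lemma c1norm_nonneg: "0 \<le> c1norm y" by (simp add: c1norm_def le_max_iff_disj)

lemma c1norm_scale: "0 \<le> t \<Longrightarrow> c1norm (t *\<^sub>R y) = t * c1norm y"
  by (simp add: c1norm_def max_mult_distrib_left)

lemma c1norm_triangle: "c1norm (y + z) \<le> c1norm y + c1norm z"
  using norm_triangle_ineq[of "fst y" "fst z"] norm_triangle_ineq[of "snd y" "snd z"]
  by (simp add: c1norm_def) linarith

lemma c1norm_eq_0: "c1norm y = 0 \<longleftrightarrow> y = 0"
  by (auto simp: c1norm_def prod_eq_iff max_def split: if_splits)

lemma scaled_norm_scale: "0 \<le> t \<Longrightarrow> scaled_norm \<rho> (t *\<^sub>R x) = t * scaled_norm \<rho> x"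
  by (simp add: scaled_norm_def c1norm_scale max_mult_distrib_left)

lemma scaled_norm_le_iff:
  assumes "0 < \<rho> 1" "0 < \<rho> 2"
  shows "scaled_norm \<rho> x \<le> 1 \<longleftrightarrow> c1norm (fst x) \<le> \<rho> 1 \<and> c1norm (snd x) \<le> \<rho> 2"
  using assms by (simp add: scaled_norm_def)

lemma scaled_norm_less_iff:
  assumes "0 < \<rho> 1" "0 < \<rho> 2"
  shows "scaled_norm \<rho> x < 1 \<longleftrightarrow> c1norm (fst x) < \<rho> 1 \<and> c1norm (snd x) < \<rho> 2"
  using assms by (simp add: scaled_norm_def)

text \<open>
The same gauge, evaluated on a pair of functions on \<open>[0,1]\<close>.
\<close>

definition scaled_C1_norm :: "(nat \<Rightarrow> real) \<Rightarrow> (real \<Rightarrow> real) \<times> (real \<Rightarrow> real) \<Rightarrow> real" where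
  "scaled_C1_norm \<rho> p = max (norm_C1 (fst p) / \<rho> 1) (norm_C1 (snd p) / \<rho> 2)"

text \<open>
The strict inequality in the extended reals leaves room for a real number in between; this
uniform gap survives integration.
\<close>

lemma sup_ratio_less:
  assumes "sup_ratio F \<rho> B < ereal M" "0 < \<rho>" "B \<noteq> {}"
  obtains L where "L < M" "\<And>t x. (t, x) \<in> B \<Longrightarrow> F t x \<le> \<rho> * L"
proof -
  have "(t, x) \<in> B \<Longrightarrow> ereal (F t x / \<rho>) \<le> sup_ratio F \<rho> B" for t x
    unfolding sup_ratio_def by (rule SUP_upper2[of "(t, x)"]) auto
  moreover obtain L where L: "sup_ratio F \<rho> B < ereal L" "L < M"
    using ereal_dense2[OF assms(1)] by auto
  ultimately have "(t, x) \<in> B \<Longrightarrow> ereal (F t x / \<rho>) < ereal L" for t x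
    using le_less_trans by blast
  then have "F t x / \<rho> < L" if "(t, x) \<in> B" for t x using that by simp
  then have "F t x \<le> \<rho> * L" if "(t, x) \<in> B" for t x
    using assms(2) that by (simp add: divide_less_eq mult.commute less_imp_le)
  then show ?thesis using that L by blast
qed

lemma inf_ratio_greater:
  assumes "ereal M < inf_ratio F \<rho> B" "0 < \<rho>"
  obtains L where "M < L" "\<And>t x. (t, x) \<in> B \<Longrightarrow> \<rho> * L \<le> F t x"
proof -
  have "(t, x) \<in> B \<Longrightarrow> inf_ratio F \<rho> B \<le> ereal (F t x / \<rho>)" for t x
    unfolding inf_ratio_def by (rule INF_lower2[of "(t, x)"]) auto
  moreover obtain L where L: "ereal L < inf_ratio F \<rho> B" "M < L"
    using ereal_dense2[OF assms(1)] by auto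
  ultimately have "(t, x) \<in> B \<Longrightarrow> ereal L < ereal (F t x / \<rho>)" for t x
    using less_le_trans by blast
  then have "L < F t x / \<rho>" if "(t, x) \<in> B" for t x using that by simp
  then have "\<rho> * L \<le> F t x" if "(t, x) \<in> B" for t x
    using assms(2) that by (simp add: less_divide_eq mult.commute less_imp_le)
  then show ?thesis using that L by blast
qed

section \<open>The operator of the system\<close>

locale hammerstein_system =
  fixes k :: "nat \<Rightarrow> real \<Rightarrow> real \<Rightarrow> real" and f :: "nat \<Rightarrow> real \<Rightarrow> real4 \<Rightarrow> real"
    and g \<phi> \<psi> :: "nat \<Rightarrow> real \<Rightarrow> real" and a b \<gamma> \<delta> c d :: "nat \<Rightarrow> real"
  assumes A1: "assm_A1 f" and A2: "assm_A2 k"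
    and A3: "assm_A3 k a b \<gamma> \<delta> \<phi> \<psi> c d" and A4: "assm_A4 g a b \<gamma> \<delta> \<phi> \<psi>"
begin

lemma kernel:
  assumes "i \<in> {1,2}"
  shows "hammerstein_kernel (k i) (g i) (\<phi> i) (\<psi> i) (a i) (b i) (c i) (\<gamma> i) (\<delta> i) (d i)"
  using assms A2 A3 A4 unfolding hammerstein_kernel_def assm_A2_def assm_A3_def assm_A4_def by blast

sublocale H1: hammerstein_kernel "k 1" "g 1" "\<phi> 1" "\<psi> 1" "a 1" "b 1" "c 1" "\<gamma> 1" "\<delta> 1" "d 1"
  by (rule kernel) simp

sublocale H2: hammerstein_kernel "k 2" "g 2" "\<phi> 2" "\<psi> 2" "a 2" "b 2" "c 2" "\<gamma> 2" "\<delta> 2" "d 2"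
  by (rule kernel) simp

definition point :: "state \<Rightarrow> real \<Rightarrow> real4" where
  "point x s = (fst (fst x) s, snd (fst x) s, fst (snd x) s, snd (snd x) s)"

definition rhs :: "nat \<Rightarrow> state \<Rightarrow> real \<Rightarrow> real" where
  "rhs i x s = f i s (point x s)"

definition T :: "state \<Rightarrow> state" where
  "T x = ((H1.u.opr (rhs 1 x), H1.du.opr (rhs 1 x)), (H2.u.opr (rhs 2 x), H2.du.opr (rhs 2 x)))"

definition K :: "state set" where
  "K = (bcone (a 1) (b 1) (c 1) \<times> bcone (\<gamma> 1) (\<delta> 1) (d 1)) \<times> (bcone (a 2) (b 2) (c 2) \<times> bcone (\<gamma> 2) (\<delta> 2) (d 2))"

definition e :: state where
  "e = ((const_bcontfun 1, const_bcontfun 1), (const_bcontfun 1, const_bcontfun 1))"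

lemma closed_K: "closed K"
  unfolding K_def by (intro closed_Times closed_bcone)

lemma f_nonneg: "i \<in> {1,2} \<Longrightarrow> s \<in> {0..1} \<Longrightarrow> 0 \<le> f i s y"
  using A1 unfolding assm_A1_def by blast

lemma rhs_nonneg: "i \<in> {1,2} \<Longrightarrow> s \<in> {0..1} \<Longrightarrow> 0 \<le> rhs i x s"
  unfolding rhs_def by (rule f_nonneg)

lemma AE_rhs_nonneg: "i \<in> {1,2} \<Longrightarrow> AE s in Leb01. 0 \<le> rhs i x s"
  by (rule AE_I2) (simp add: rhs_nonneg)

lemma point_bounds:
  assumes "0 < \<rho> 1" "0 < \<rho> 2" "scaled_norm \<rho> x \<le> 1"
  shows "fst (fst x) s \<in> {- \<rho> 1..\<rho> 1}" "snd (fst x) s \<in> {- \<rho> 1..\<rho> 1}"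
    "fst (snd x) s \<in> {- \<rho> 2..\<rho> 2}" "snd (snd x) s \<in> {- \<rho> 2..\<rho> 2}"
proof -
  have n: "norm (fst (fst x)) \<le> \<rho> 1" "norm (snd (fst x)) \<le> \<rho> 1" "norm (fst (snd x)) \<le> \<rho> 2" "norm (snd (snd x)) \<le> \<rho> 2"
    using assms by (auto simp: scaled_norm_le_iff c1norm_def)
  have *: "U s \<in> {-r..r}" if "norm U \<le> r" for U :: cfun and r
    using norm_bounded[of U s] that by (auto simp: abs_le_iff)
  show "fst (fst x) s \<in> {- \<rho> 1..\<rho> 1}" "snd (fst x) s \<in> {- \<rho> 1..\<rho> 1}"
    "fst (snd x) s \<in> {- \<rho> 2..\<rho> 2}" "snd (snd x) s \<in> {- \<rho> 2..\<rho> 2}"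
    using n by (auto intro!: * simp del: atLeastAtMost_iff)
qed

lemma rhs_measurable:
  assumes "i \<in> {1,2}" shows "rhs i x \<in> borel_measurable Leb01"
proof -
  have "(\<lambda>s. f i s (point x s)) \<in> borel_measurable Leb01"
  proof (rule superposition_measurable[where F = "f i" and w = "point x"])
    show "(\<lambda>s. f i s y) \<in> borel_measurable Leb01" for y using A1 assms unfolding assm_A1_def by blast
    show "AE s in Leb01. continuous_on UNIV (f i s)" using A1 assms unfolding assm_A1_def by blast
    show "continuous_on UNIV (point x)"
      unfolding point_def[abs_def] by (intro continuous_on_Pair continuous_on_apply_bcontfun)
  qed
  then show ?thesis by (simp add: rhs_def[abs_def])
qed

text \<open>
One essential bound for all quadruples in a box: it comes from the growth bound of the nonlinearity on
a cube that contains the box.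
\<close>

lemma rhs_ess_bounded:
  assumes i: "i \<in> {1,2}" and r: "0 < r 1" "0 < r 2"
  obtains H where "\<And>x. scaled_norm r x \<le> 1 \<Longrightarrow> rhs i x \<in> ess_bounded H"
proof -
  define R where "R = max (r 1) (r 2)"
  have "0 < R" using r by (simp add: R_def)
  then obtain h where h: "h \<in> Linfty01"
    and fh: "AE t in Leb01. \<forall>x\<in>{-R..R} \<times> {-R..R} \<times> {-R..R} \<times> {-R..R}. f i t x \<le> h t"
    using A1 i unfolding assm_A1_def by blast
  obtain H where H: "h \<in> ess_bounded H" using h by (rule Linfty01_ess_bounded)
  have "rhs i x \<in> ess_bounded H" if x: "scaled_norm r x \<le> 1" for x
  proof -
    have pt: "point x s \<in> {-R..R} \<times> {-R..R} \<times> {-R..R} \<times> {-R..R}" for s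
      using point_bounds[OF r x, of s] by (auto simp: point_def R_def)
    have "AE s in Leb01. \<bar>h s\<bar> \<le> H" using H by (simp add: ess_bounded_def)
    with fh AE_rhs_nonneg[OF i, of x] have "AE s in Leb01. \<bar>rhs i x s\<bar> \<le> H"
    proof eventually_elim
      case (elim s)
      have "f i s (point x s) \<le> h s" using elim(1) pt by blast
      then show ?case using elim(2,3) unfolding rhs_def by linarith
    qed
    then show ?thesis using rhs_measurable[OF i] by (simp add: ess_bounded_def)
  qed
  then show ?thesis using that by blast
qed

lemma rhs_ess_bounded': "i \<in> {1,2} \<Longrightarrow> \<exists>H. rhs i x \<in> ess_bounded H"
proof -
  assume i: "i \<in> {1,2}"
  let ?r = "\<lambda>_. 1 + c1norm (fst x) + c1norm (snd x)"
  have pos: "0 < 1 + c1norm (fst x) + c1norm (snd x)" 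
    using c1norm_nonneg[of "fst x"] c1norm_nonneg[of "snd x"] by linarith
  have "scaled_norm ?r x \<le> 1"
    using pos c1norm_nonneg[of "fst x"] c1norm_nonneg[of "snd x"] by (simp add: scaled_norm_le_iff)
  with rhs_ess_bounded[OF i, of ?r] pos show ?thesis by metis
qed

lemma T_in_K: "T x \<in> K"
proof -
  obtain H where 1: "rhs 1 x \<in> ess_bounded H" using rhs_ess_bounded'[of 1 x] by auto
  obtain H' where 2: "rhs 2 x \<in> ess_bounded H'" using rhs_ess_bounded'[of 2 x] by auto
  have 0: "AE s in Leb01. 0 \<le> rhs 1 x s" "AE s in Leb01. 0 \<le> rhs 2 x s" using AE_rhs_nonneg by auto
  show ?thesis
    unfolding K_def T_def bcone_def
    using H1.u.opr_cone[OF 1 0(1)] H1.du.opr_cone[OF 1 0(1)] H2.u.opr_cone[OF 2 0(2)] H2.du.opr_cone[OF 2 0(2)]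
    by blast
qed

lemma T_compact:
  assumes r: "0 < r 1" "0 < r 2"
  obtains C where "compact C" "C \<subseteq> K" "\<And>x. scaled_norm r x \<le> 1 \<Longrightarrow> T x \<in> C"
proof -
  obtain H where 1: "\<And>x. scaled_norm r x \<le> 1 \<Longrightarrow> rhs 1 x \<in> ess_bounded H" using rhs_ess_bounded[of 1 r] r by auto
  obtain H' where 2: "\<And>x. scaled_norm r x \<le> 1 \<Longrightarrow> rhs 2 x \<in> ess_bounded H'" using rhs_ess_bounded[of 2 r] r by auto
  obtain C1 where C1: "compact C1" "H1.u.opr ` ess_bounded H \<subseteq> C1" by (rule H1.u.opr_compact)
  obtain D1 where D1: "compact D1" "H1.du.opr ` ess_bounded H \<subseteq> D1" by (rule H1.du.opr_compact)
  obtain C2 where C2: "compact C2" "H2.u.opr ` ess_bounded H' \<subseteq> C2" by (rule H2.u.opr_compact)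
  obtain D2 where D2: "compact D2" "H2.du.opr ` ess_bounded H' \<subseteq> D2" by (rule H2.du.opr_compact)
  show ?thesis
  proof
    show "compact (K \<inter> ((C1 \<times> D1) \<times> (C2 \<times> D2)))"
      using C1 D1 C2 D2 by (intro closed_Int_compact closed_K compact_Times)
    show "T x \<in> K \<inter> ((C1 \<times> D1) \<times> (C2 \<times> D2))" if "scaled_norm r x \<le> 1" for x
      using T_in_K[of x] 1[OF that] 2[OF that] C1(2) D1(2) C2(2) D2(2) by (auto simp: T_def)
  qed auto
qed

lemma T_continuous:
  assumes r: "0 < r 1" "0 < r 2" and S: "\<And>x. x \<in> S \<Longrightarrow> scaled_norm r x \<le> 1"
  shows "continuous_on S T"
  unfolding continuous_on_sequentially
proof (intro allI ballI impI, elim conjE)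
  fix x :: "nat \<Rightarrow> state" and l assume l: "l \<in> S" and x: "\<forall>n. x n \<in> S" and lim: "x \<longlonglongrightarrow> l"
  obtain H where 1: "\<And>x. scaled_norm r x \<le> 1 \<Longrightarrow> rhs 1 x \<in> ess_bounded H" using rhs_ess_bounded[of 1 r] r by auto
  obtain H' where 2: "\<And>x. scaled_norm r x \<le> 1 \<Longrightarrow> rhs 2 x \<in> ess_bounded H'" using rhs_ess_bounded[of 2 r] r by auto
  have pt: "(\<lambda>n. point (x n) s) \<longlonglongrightarrow> point l s" for s
  proof -
    have *: "(\<lambda>n. U n s) \<longlonglongrightarrow> V s" if "U \<longlonglongrightarrow> V" for U :: "nat \<Rightarrow> cfun" and V
      by (rule continuous_on_tendsto_compose[OF continuous_on_eval[of UNIV s] that]) auto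
    show ?thesis unfolding point_def by (intro tendsto_Pair * tendsto_fst tendsto_snd lim)
  qed
  have rhs_lim: "AE s in Leb01. (\<lambda>n. rhs i (x n) s) \<longlonglongrightarrow> rhs i l s" if i: "i \<in> {1,2}" for i
  proof -
    have "AE s in Leb01. continuous_on UNIV (f i s)" using A1 i unfolding assm_A1_def by blast
    then show ?thesis
    proof eventually_elim
      case (elim s)
      show ?case unfolding rhs_def by (rule continuous_on_tendsto_compose[OF elim pt]) auto
    qed
  qed
  have b1: "rhs 1 (x n) \<in> ess_bounded H" and b2: "rhs 2 (x n) \<in> ess_bounded H'" for n
    using 1 2 S x by auto
  have l1: "rhs 1 l \<in> ess_bounded H" and l2: "rhs 2 l \<in> ess_bounded H'" using 1 2 S l by auto
  have "(\<lambda>n. T (x n)) \<longlonglongrightarrow> T l"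
    unfolding T_def
    by (intro tendsto_Pair H1.u.opr_tendsto[OF b1 l1] H1.du.opr_tendsto[OF b1 l1]
        H2.u.opr_tendsto[OF b2 l2] H2.du.opr_tendsto[OF b2 l2] rhs_lim) auto
  then show "(T \<circ> x) \<longlonglongrightarrow> T l" by (simp add: o_def)
qed

lemma scaled_norm_T_less_1:
  assumes r: "0 < r 1" "0 < r 2" and I1: "cond_I1 k g f r" and x: "scaled_norm r x \<le> 1"
  shows "scaled_norm r (T x) < 1"
proof -
  let ?B = "{0..1::real} \<times> {-r 1..r 1} \<times> {-r 1..r 1} \<times> {-r 2..r 2} \<times> {-r 2..r 2}"
  have box: "(s, point x s) \<in> ?B" if "s \<in> {0..1}" for s
    using point_bounds[OF r x, of s] that by (auto simp: point_def)
  have "(0, point x 0) \<in> ?B" by (rule box) simp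
  then have ne: "?B \<noteq> {}" by (metis empty_iff)
  have "sup_ratio (f 1) (r 1) ?B < ereal (min (const_m (k 1) (g 1)) (const_m_star (k 1) (g 1)))"
    using I1 by (simp add: cond_I1_def)
  then obtain L1 where L1: "L1 < min (const_m (k 1) (g 1)) (const_m_star (k 1) (g 1))"
    "\<And>s y. (s, y) \<in> ?B \<Longrightarrow> f 1 s y \<le> r 1 * L1"
    using sup_ratio_less[OF _ r(1) ne] by metis
  have "sup_ratio (f 2) (r 2) ?B < ereal (min (const_m (k 2) (g 2)) (const_m_star (k 2) (g 2)))"
    using I1 by (simp add: cond_I1_def)
  then obtain L2 where L2: "L2 < min (const_m (k 2) (g 2)) (const_m_star (k 2) (g 2))"
    "\<And>s y. (s, y) \<in> ?B \<Longrightarrow> f 2 s y \<le> r 2 * L2"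
    using sup_ratio_less[OF _ r(2) ne] by metis
  have 1: "rhs 1 x s \<le> r 1 * L1" and 2: "rhs 2 x s \<le> r 2 * L2" if "s \<in> {0..1}" for s
    using L1(2) L2(2) box[OF that] by (auto simp: rhs_def simp del: mem_Sigma_iff)
  have "norm (H1.u.opr (rhs 1 x)) < r 1" "norm (H1.du.opr (rhs 1 x)) < r 1"
    using H1.norm_less_if_below_m[OF rhs_measurable rhs_nonneg 1 r(1) L1(1)] by auto
  moreover have "norm (H2.u.opr (rhs 2 x)) < r 2" "norm (H2.du.opr (rhs 2 x)) < r 2"
    using H2.norm_less_if_below_m[OF rhs_measurable rhs_nonneg 2 r(2) L2(1)] by auto
  ultimately show ?thesis by (simp add: scaled_norm_less_iff[of r, OF r] c1norm_def T_def)
qed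

lemma I1_boundary:
  assumes r: "0 < r 1" "0 < r 2" and I1: "cond_I1 k g f r" and x: "scaled_norm r x = 1" and t: "1 \<le> t"
  shows "T x \<noteq> t *\<^sub>R x"
  using scaled_norm_T_less_1[OF r I1, of x] scaled_norm_scale[of t r x] x t by auto

text \<open>
On the boundary of the box one of the four entries attains its radius as a norm. Its cone
condition places the quadruple, over the subinterval of that entry, in the region where the infimum in
\<open>cond_I0\<close> is taken. The same entry of \<open>T x\<close> is then above the radius at a point of that subinterval, so \<open>x\<close> cannot
dominate \<open>T x\<close>.
\<close>

lemma I0_boundary:
  assumes r: "0 < r 1" "0 < r 2" and I0: "cond_I0 k g f a b \<gamma> \<delta> c d r"
    and x: "x \<in> K" "scaled_norm r x = 1" and t: "0 \<le> t"
  shows "x \<noteq> T x + t *\<^sub>R e"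
proof
  assume eq: "x = T x + t *\<^sub>R e"
  obtain U U' V V' where xU: "x = ((U, U'), (V, V'))" by (metis prod.exhaust)
  have TU: "U = H1.u.opr (rhs 1 x) + t *\<^sub>R const_bcontfun 1" "U' = H1.du.opr (rhs 1 x) + t *\<^sub>R const_bcontfun 1"
    "V = H2.u.opr (rhs 2 x) + t *\<^sub>R const_bcontfun 1" "V' = H2.du.opr (rhs 2 x) + t *\<^sub>R const_bcontfun 1"
    using eq unfolding T_def e_def xU by simp_all
  have le: "H1.u.opr (rhs 1 x) s \<le> U s" "H1.du.opr (rhs 1 x) s \<le> U' s"
    "H2.u.opr (rhs 2 x) s \<le> V s" "H2.du.opr (rhs 2 x) s \<le> V' s" for s
    using t by (subst TU; simp)+
  have x1: "scaled_norm r x \<le> 1" using x by simp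
  have bd: "U s \<in> {-r 1..r 1}" "U' s \<in> {-r 1..r 1}" "V s \<in> {-r 2..r 2}" "V' s \<in> {-r 2..r 2}" for s
    using point_bounds[OF r x1, of s] by (simp_all add: xU)
  have pt: "point x s = (U s, U' s, V s, V' s)" for s by (simp add: point_def xU)
  obtain H where h1: "rhs 1 x \<in> ess_bounded H" using rhs_ess_bounded'[of 1 x] by auto
  obtain H' where h2: "rhs 2 x \<in> ess_bounded H'" using rhs_ess_bounded'[of 2 x] by auto
  have nn: "0 \<le> rhs 1 x s" "0 \<le> rhs 2 x s" if "s \<in> {0..1}" for s using rhs_nonneg that by auto
  have cones: "U \<in> bcone (a 1) (b 1) (c 1)" "U' \<in> bcone (\<gamma> 1) (\<delta> 1) (d 1)"
    "V \<in> bcone (a 2) (b 2) (c 2)" "V' \<in> bcone (\<gamma> 2) (\<delta> 2) (d 2)"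
    using x(1) by (auto simp: K_def xU)
  note I = I0[unfolded cond_I0_def]
  have "norm U = r 1 \<or> norm U' = r 1 \<or> norm V = r 2 \<or> norm V' = r 2"
    using x(2) r by (auto simp: scaled_norm_def c1norm_def xU max_def split: if_splits)
  then consider "norm U = r 1" | "norm U' = r 1" | "norm V = r 2" | "norm V' = r 2" by blast
  then show False
  proof cases
    case 1
    obtain L where L: "const_M (k 1) (g 1) (a 1) (b 1) < L"
      "\<And>s y. (s, y) \<in> {a 1..b 1} \<times> {c 1 * r 1..r 1} \<times> {-r 1..r 1} \<times> {-r 2..r 2} \<times> {-r 2..r 2} \<Longrightarrow> r 1 * L \<le> f 1 s y"
      by (rule inf_ratio_greater[OF I[THEN conjunct1] r(1)]) (rule that)
    have hB: "r 1 * L \<le> rhs 1 x s" if s: "s \<in> {a 1..b 1}" for s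
      unfolding rhs_def pt
      by (rule L(2)) (use s cones(1) bd[of s] 1 in \<open>auto simp: bcone_def\<close>)
    have "r 1 < H1.u.opr (rhs 1 x) (a 1)"
      by (rule H1.opr_greater_if_above_M[OF h1 _ _ r(1) L(1)]) (use nn hB H1.ab in auto)
    then show False using le(1)[of "a 1"] bd(1)[of "a 1"] by simp
  next
    case 2
    obtain L where L: "const_M_star (k 1) (g 1) (\<gamma> 1) (\<delta> 1) < L"
      "\<And>s y. (s, y) \<in> {\<gamma> 1..\<delta> 1} \<times> {-r 1..r 1} \<times> {d 1 * r 1..r 1} \<times> {-r 2..r 2} \<times> {-r 2..r 2} \<Longrightarrow> r 1 * L \<le> f 1 s y"
      by (rule inf_ratio_greater[OF I[THEN conjunct2, THEN conjunct1] r(1)]) (rule that)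
    have hB: "r 1 * L \<le> rhs 1 x s" if s: "s \<in> {\<gamma> 1..\<delta> 1}" for s
      unfolding rhs_def pt
      by (rule L(2)) (use s cones(2) bd[of s] 2 in \<open>auto simp: bcone_def\<close>)
    have "r 1 < H1.du.opr (rhs 1 x) (\<gamma> 1)"
      by (rule H1.opr_greater_if_above_M_star[OF h1 _ _ r(1) L(1)]) (use nn hB H1.\<gamma>\<delta> in auto)
    then show False using le(2)[of "\<gamma> 1"] bd(2)[of "\<gamma> 1"] by simp
  next
    case 3
    obtain L where L: "const_M (k 2) (g 2) (a 2) (b 2) < L"
      "\<And>s y. (s, y) \<in> {a 2..b 2} \<times> {-r 1..r 1} \<times> {-r 1..r 1} \<times> {c 2 * r 2..r 2} \<times> {-r 2..r 2} \<Longrightarrow> r 2 * L \<le> f 2 s y"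
      by (rule inf_ratio_greater[OF I[THEN conjunct2, THEN conjunct2, THEN conjunct1] r(2)]) (rule that)
    have hB: "r 2 * L \<le> rhs 2 x s" if s: "s \<in> {a 2..b 2}" for s
      unfolding rhs_def pt
      by (rule L(2)) (use s cones(3) bd[of s] 3 in \<open>auto simp: bcone_def\<close>)
    have "r 2 < H2.u.opr (rhs 2 x) (a 2)"
      by (rule H2.opr_greater_if_above_M[OF h2 _ _ r(2) L(1)]) (use nn hB H2.ab in auto)
    then show False using le(3)[of "a 2"] bd(3)[of "a 2"] by simp
  next
    case 4
    obtain L where L: "const_M_star (k 2) (g 2) (\<gamma> 2) (\<delta> 2) < L"
      "\<And>s y. (s, y) \<in> {\<gamma> 2..\<delta> 2} \<times> {-r 1..r 1} \<times> {-r 1..r 1} \<times> {-r 2..r 2} \<times> {d 2 * r 2..r 2} \<Longrightarrow> r 2 * L \<le> f 2 s y"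
      by (rule inf_ratio_greater[OF I[THEN conjunct2, THEN conjunct2, THEN conjunct2] r(2)]) (rule that)
    have hB: "r 2 * L \<le> rhs 2 x s" if s: "s \<in> {\<gamma> 2..\<delta> 2}" for s
      unfolding rhs_def pt
      by (rule L(2)) (use s cones(4) bd[of s] 4 in \<open>auto simp: bcone_def\<close>)
    have "r 2 < H2.du.opr (rhs 2 x) (\<gamma> 2)"
      by (rule H2.opr_greater_if_above_M_star[OF h2 _ _ r(2) L(1)]) (use nn hB H2.\<gamma>\<delta> in auto)
    then show False using le(4)[of "\<gamma> 2"] bd(4)[of "\<gamma> 2"] by simp
  qed
qed

lemma gauged_cone_K:
  assumes \<rho>: "0 < \<rho> 1" "0 < \<rho> 2" and r: "\<rho> 1 < r 1" "\<rho> 2 < r 2"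
  shows "gauged_cone K e (scaled_norm \<rho>) (scaled_norm r) (max (r 1 / \<rho> 1) (r 2 / \<rho> 2))"
proof
  have r0: "0 < r 1" "0 < r 2" using \<rho> r by auto
  show "t *\<^sub>R x \<in> K" if "0 \<le> t" "x \<in> K" for t x
    using that by (auto simp: K_def bcone_scale)
  show "x + y \<in> K" if "x \<in> K" "y \<in> K" for x y
    using that H1.c H1.d H2.c H2.d by (auto simp: K_def intro!: bcone_add)
  show "e \<in> K"
    unfolding e_def K_def using bcone_const H1.c H1.d H2.c H2.d by blast
  show "e \<noteq> 0"
  proof
    assume "e = 0"
    then have "(const_bcontfun 1 :: cfun) = 0" by (simp add: e_def prod_eq_iff)
    then have "apply_bcontfun (const_bcontfun 1 :: cfun) 0 = apply_bcontfun 0 0" by simp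
    then show False by simp
  qed
  show "continuous_on UNIV (scaled_norm \<rho>)" "continuous_on UNIV (scaled_norm r)"
    unfolding scaled_norm_def c1norm_def using \<rho> r0 by (auto intro!: continuous_intros)
  show "scaled_norm \<rho> (t *\<^sub>R x) = t * scaled_norm \<rho> x" "scaled_norm r (t *\<^sub>R x) = t * scaled_norm r x" if "0 \<le> t" for t x
    using that by (simp_all add: scaled_norm_scale)
  show "scaled_norm r (x + y) \<le> scaled_norm r x + scaled_norm r y" for x y
  proof -
    have "c1norm (fst x + fst y) / r 1 \<le> c1norm (fst x) / r 1 + c1norm (fst y) / r 1"
      "c1norm (snd x + snd y) / r 2 \<le> c1norm (snd x) / r 2 + c1norm (snd y) / r 2"
      unfolding add_divide_distrib[symmetric] using r0 by (auto intro!: divide_right_mono c1norm_triangle)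
    then show ?thesis unfolding scaled_norm_def by (simp add: le_max_iff_disj) linarith
  qed
  show "0 < scaled_norm r x" if "x \<noteq> 0" for x
  proof -
    have "c1norm (fst x) \<noteq> 0 \<or> c1norm (snd x) \<noteq> 0" using that by (auto simp: c1norm_eq_0 prod_eq_iff)
    then have "0 < c1norm (fst x) \<or> 0 < c1norm (snd x)" using c1norm_nonneg[of "fst x"] c1norm_nonneg[of "snd x"] by linarith
    then show ?thesis using r0 by (auto simp: scaled_norm_def less_max_iff_disj)
  qed
  show "scaled_norm r x \<le> scaled_norm \<rho> x" for x
    unfolding scaled_norm_def using \<rho> r by (intro max.mono divide_left_mono) (auto simp: c1norm_nonneg)
  show "scaled_norm \<rho> x \<le> max (r 1 / \<rho> 1) (r 2 / \<rho> 2) * scaled_norm r x" for x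
  proof -
    let ?m = "max (r 1 / \<rho> 1) (r 2 / \<rho> 2)"
    have m0: "0 \<le> ?m" using \<rho> r0 by (simp add: le_max_iff_disj)
    have "c1norm (fst x) / \<rho> 1 = r 1 / \<rho> 1 * (c1norm (fst x) / r 1)" "c1norm (snd x) / \<rho> 2 = r 2 / \<rho> 2 * (c1norm (snd x) / r 2)"
      using r0 by auto
    moreover have "r 1 / \<rho> 1 * (c1norm (fst x) / r 1) \<le> ?m * scaled_norm r x" "r 2 / \<rho> 2 * (c1norm (snd x) / r 2) \<le> ?m * scaled_norm r x"
      using m0 r0 by (auto intro!: mult_mono simp: scaled_norm_def c1norm_nonneg simp del: times_divide_eq_left times_divide_eq_right)
    ultimately show ?thesis by (simp add: scaled_norm_def del: times_divide_eq_left times_divide_eq_right)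
  qed
qed

text \<open>
The boundary conditions with \<open>t = 1\<close> and \<open>t = 0\<close> say that there is no fixed point on either boundary;
this is why the inequalities are strict.
\<close>

lemma fixed_point_in_ring:
  assumes \<rho>: "0 < \<rho> 1" "0 < \<rho> 2" and r: "\<rho> 1 < r 1" "\<rho> 2 < r 2"
    and I: "cond_I0 k g f a b \<gamma> \<delta> c d \<rho> \<and> cond_I1 k g f r \<or> cond_I1 k g f \<rho> \<and> cond_I0 k g f a b \<gamma> \<delta> c d r"
  obtains x where "x \<in> K" "T x = x" "1 < scaled_norm \<rho> x" "scaled_norm r x < 1"
proof -
  have r0: "0 < r 1" "0 < r 2" using \<rho> r by auto
  interpret gauged_cone K e "scaled_norm \<rho>" "scaled_norm r" "max (r 1 / \<rho> 1) (r 2 / \<rho> 2)"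
    by (rule gauged_cone_K[OF \<rho> r])
  have sub: "x \<in> K" "scaled_norm r x \<le> 1" if "x \<in> annulus" for x using that by (auto simp: annulus_def)
  obtain C where C: "compact C" "C \<subseteq> K" "\<And>x. scaled_norm r x \<le> 1 \<Longrightarrow> T x \<in> C" by (rule T_compact[OF r0]) (rule that)
  have cont: "continuous_on annulus T" by (rule T_continuous[OF r0 sub(2)])
  have im: "T ` annulus \<subseteq> C" using C(3) sub by blast
  have boundary: "scaled_norm \<rho> x \<noteq> 1 \<and> scaled_norm r x \<noteq> 1" if "T x = x" "x \<in> K" for x
    using I
  proof
    assume "cond_I0 k g f a b \<gamma> \<delta> c d \<rho> \<and> cond_I1 k g f r"
    then show ?thesis
      using I0_boundary[OF \<rho> _ that(2), of 0] I1_boundary[OF r0, of x 1] that(1) by auto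
  next
    assume "cond_I1 k g f \<rho> \<and> cond_I0 k g f a b \<gamma> \<delta> c d r"
    then show ?thesis
      using I1_boundary[OF \<rho>, of x 1] I0_boundary[OF r0 _ that(2), of 0] that(1) by auto
  qed
  from I have "\<exists>x\<in>annulus. T x = x"
  proof
    assume *: "cond_I0 k g f a b \<gamma> \<delta> c d \<rho> \<and> cond_I1 k g f r"
    show ?thesis
      by (rule compression[OF cont im C(1,2)]) (use * I0_boundary[OF \<rho>] I1_boundary[OF r0] sub in blast)+
  next
    assume *: "cond_I1 k g f \<rho> \<and> cond_I0 k g f a b \<gamma> \<delta> c d r"
    show ?thesis
      by (rule expansion[OF cont im C(1,2)]) (use * I0_boundary[OF r0] I1_boundary[OF \<rho>] sub in blast)+
  qed
  then obtain x where x: "x \<in> annulus" "T x = x" by blast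
  then show ?thesis
    using that[of x] boundary[OF x(2)] by (force simp: annulus_def)
qed

definition sol :: "state \<Rightarrow> (real \<Rightarrow> real) \<times> (real \<Rightarrow> real)" where
  "sol x = (restrict (fst (fst x)) {0..1}, restrict (fst (snd x)) {0..1})"

end

section \<open>From fixed points to solutions\<close>

context hammerstein_kernel
begin

text \<open>
A fixed point recovers the derivative relation that was dropped from the cone: both entries are
integrals of the same density, and the second one is the derivative of the first. The two norms agree
because the extension to the line by boundary values leaves the supremum unchanged.
\<close>

lemma fixed_component:
  assumes h: "h \<in> ess_bounded H" and U: "U = u.opr h" and U': "U' = du.opr h"
    and cone: "U \<in> bcone a b c" "U' \<in> bcone \<gamma> \<delta> d"
  shows "\<forall>t\<in>{0..1}. D01 (restrict U {0..1}) t = U' t"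
    and "\<forall>t\<in>{0..1}. U t = (LINT s|Leb01. k t s * g s * h s)"
    and "norm_C1 (restrict U {0..1}) = max (norm U) (norm U')"
    and "restrict U {0..1} \<in> cone_comp a b \<gamma> \<delta> c d"
proof -
  let ?w = "restrict U {0..1}"
  have Ut: "U t = u.val h t" and U't: "U' t = du.val h t" if "t \<in> {0..1}" for t
    using u.opr_apply[OF h] du.opr_apply[OF h] clip01(2)[OF that] by (simp_all add: U U')
  have clip: "U (clip01 t) = U t" "U' (clip01 t) = U' t" for t
    using u.opr_apply[OF h] du.opr_apply[OF h] clip01(2)[OF clip01(1)] by (simp_all add: U U')
  have deriv: "(?w has_real_derivative U' t) (at t within {0..1})" if t: "t \<in> {0..1}" for t
  proof (rule has_field_derivative_transform_within[OF _ zero_less_one t])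
    show "(u.val h has_real_derivative U' t) (at t within {0..1})"
      using val_derivative[OF h t] U't[OF t] by simp
  qed (simp add: Ut)
  show D: "\<forall>t\<in>{0..1}. D01 ?w t = U' t"
    using D01_eqI[OF deriv] by blast
  show "\<forall>t\<in>{0..1}. U t = (LINT s|Leb01. k t s * g s * h s)"
    using Ut by (simp add: u.val_def)
  have norm_eq: "norm_C v = norm V" if v: "\<And>t. t \<in> {0..1} \<Longrightarrow> v t = V t" and V: "\<And>t. V (clip01 t) = V t" for v :: "real \<Rightarrow> real" and V :: cfun
  proof (rule antisym)
    have bd: "bdd_above ((\<lambda>t. \<bar>v t\<bar>) ` {0..1})"
      by (rule bdd_aboveI2[of _ _ "norm V"]) (use norm_bounded[of V] v in auto)
    show "norm_C v \<le> norm V"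
      unfolding norm_C_def by (rule cSUP_least) (use norm_bounded[of V] v in auto)
    show "norm V \<le> norm_C v"
    proof (rule norm_bound)
      fix t
      have "norm (V t) = \<bar>v (clip01 t)\<bar>" using v[OF clip01(1)] V by simp
      also have "\<dots> \<le> norm_C v" unfolding norm_C_def by (rule cSUP_upper[OF clip01(1) bd])
      finally show "norm (V t) \<le> norm_C v" .
    qed
  qed
  have nU: "norm_C ?w = norm U" by (rule norm_eq) (auto simp: clip)
  have nU': "norm_C (D01 ?w) = norm U'" by (rule norm_eq) (use D clip in auto)
  show "norm_C1 ?w = max (norm U) (norm U')" by (simp add: norm_C1_def nU nU')
  show "?w \<in> cone_comp a b \<gamma> \<delta> c d"
    unfolding cone_comp_def C1_01_def
  proof (intro CollectI conjI ballI)
    show "?w \<in> extensional {0..1}" by simp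
    show "?w differentiable (at t within {0..1})" if "t \<in> {0..1}" for t
      using deriv[OF that] by (meson differentiableI has_field_derivative_imp_has_derivative)
    show "continuous_on {0..1} (D01 ?w)"
      by (rule continuous_on_eq[of _ "apply_bcontfun U'"]) (use D in auto)
    show "c * norm_C ?w \<le> (INF t\<in>{a..b}. ?w t)"
      unfolding nU by (rule cINF_greatest) (use ab cone(1) in \<open>auto simp: bcone_def\<close>)
    show "d * norm_C (D01 ?w) \<le> (INF t\<in>{\<gamma>..\<delta>}. D01 ?w t)"
      unfolding nU' by (rule cINF_greatest) (use \<gamma>\<delta> cone(2) D in \<open>auto simp: bcone_def\<close>)
  qed
qed

end

context hammerstein_system
begin

lemma solution_of_fixed_point:
  assumes x: "x \<in> K" and fx: "T x = x"
  shows "sol x \<in> cone_K a b \<gamma> \<delta> c d" "solves_system k g f (sol x)" "scaled_C1_norm \<rho> (sol x) = scaled_norm \<rho> x"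
proof -
  obtain U U' V V' where xU: "x = ((U, U'), (V, V'))" by (metis prod.exhaust)
  have eqs: "U = H1.u.opr (rhs 1 x)" "U' = H1.du.opr (rhs 1 x)" "V = H2.u.opr (rhs 2 x)" "V' = H2.du.opr (rhs 2 x)"
    using fx unfolding T_def by (simp_all add: xU)
  obtain H where 1: "rhs 1 x \<in> ess_bounded H" using rhs_ess_bounded'[of 1 x] by auto
  obtain H' where 2: "rhs 2 x \<in> ess_bounded H'" using rhs_ess_bounded'[of 2 x] by auto
  have cones: "U \<in> bcone (a 1) (b 1) (c 1)" "U' \<in> bcone (\<gamma> 1) (\<delta> 1) (d 1)"
    "V \<in> bcone (a 2) (b 2) (c 2)" "V' \<in> bcone (\<gamma> 2) (\<delta> 2) (d 2)"
    using x by (auto simp: K_def xU)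
  note u = H1.fixed_component[OF 1 eqs(1,2) cones(1,2)]
  note v = H2.fixed_component[OF 2 eqs(3,4) cones(3,4)]
  have s: "sol x = (restrict U {0..1}, restrict V {0..1})" by (simp add: sol_def xU)
  show "sol x \<in> cone_K a b \<gamma> \<delta> c d" using u(4) v(4) by (simp add: s cone_K_def)
  show "scaled_C1_norm \<rho> (sol x) = scaled_norm \<rho> x" unfolding s by (simp add: scaled_C1_norm_def scaled_norm_def u(3) v(3) xU c1norm_def)
  let ?u = "restrict U {0..1}" and ?v = "restrict V {0..1}"
  have rhs_eq: "rhs i x s = f i s (?u s, D01 ?u s, ?v s, D01 ?v s)" if "s \<in> {0..1}" for i s
    using that u(1) v(1) by (simp add: rhs_def point_def xU)
  show "solves_system k g f (sol x)"
    unfolding solves_system_def s prod.case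
  proof (intro ballI conjI)
    fix t :: real assume t: "t \<in> {0..1}"
    have "?u t = (LINT s|Leb01. k 1 t s * g 1 s * rhs 1 x s)" using u(2) t by simp
    also have "\<dots> = (LINT s|Leb01. k 1 t s * g 1 s * f 1 s (?u s, D01 ?u s, ?v s, D01 ?v s))"
      by (rule Bochner_Integration.integral_cong) (use rhs_eq in auto)
    finally show "?u t = (LINT s|Leb01. k 1 t s * g 1 s * f 1 s (?u s, D01 ?u s, ?v s, D01 ?v s))" .
    have "?v t = (LINT s|Leb01. k 2 t s * g 2 s * rhs 2 x s)" using v(2) t by simp
    also have "\<dots> = (LINT s|Leb01. k 2 t s * g 2 s * f 2 s (?u s, D01 ?u s, ?v s, D01 ?v s))"
      by (rule Bochner_Integration.integral_cong) (use rhs_eq in auto)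
    finally show "?v t = (LINT s|Leb01. k 2 t s * g 2 s * f 2 s (?u s, D01 ?u s, ?v s, D01 ?v s))" .
  qed
qed

lemma solution_in_ring:
  assumes \<rho>r: "\<forall>i\<in>{1,2}. 0 < \<rho> i \<and> \<rho> i < r i"
    and I: "cond_I0 k g f a b \<gamma> \<delta> c d \<rho> \<and> cond_I1 k g f r \<or> cond_I1 k g f \<rho> \<and> cond_I0 k g f a b \<gamma> \<delta> c d r"
  obtains p where "p \<in> nontrivial_solutions k g f (cone_K a b \<gamma> \<delta> c d)" "1 < scaled_C1_norm \<rho> p" "scaled_C1_norm r p < 1"
proof -
  obtain x where x: "x \<in> K" "T x = x" "1 < scaled_norm \<rho> x" "scaled_norm r x < 1"
    by (rule fixed_point_in_ring[of \<rho> r]) (use \<rho>r I in auto)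
  note sol = solution_of_fixed_point[OF x(1,2)]
  have p1: "1 < scaled_C1_norm \<rho> (sol x)" using x sol(3) by simp
  have "norm_prod (sol x) \<noteq> 0"
  proof
    assume "norm_prod (sol x) = 0"
    then have "norm_C1 (fst (sol x)) \<le> 0" "norm_C1 (snd (sol x)) \<le> 0"
      by (auto simp: norm_prod_def case_prod_unfold max_def split: if_splits)
    then have "scaled_C1_norm \<rho> (sol x) \<le> 0"
      using \<rho>r by (auto simp: scaled_C1_norm_def divide_nonpos_pos)
    with p1 show False by simp
  qed
  then show ?thesis
    using that[of "sol x"] sol(1,2) sol(3)[of r] p1 x(4) by (simp add: nontrivial_solutions_def)
qed

end

section \<open>Counting the rings\<close>

lemma scaled_C1_norm_less_1_mono:
  assumes "scaled_C1_norm r p < 1" "\<forall>i\<in>{1,2}. 0 < r i \<and> r i < s i"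
  shows "scaled_C1_norm s p < 1"
  using assms by (auto simp: scaled_C1_norm_def)

lemma has_at_least_1: "p \<in> A \<Longrightarrow> has_at_least 1 A"
  unfolding has_at_least_def by (intro exI[of _ "{p}"]) auto

lemma has_at_least_2: "p \<in> A \<Longrightarrow> q \<in> A \<Longrightarrow> p \<noteq> q \<Longrightarrow> has_at_least 2 A"
  unfolding has_at_least_def by (intro exI[of _ "{p, q}"]) auto

lemma has_at_least_3: "p \<in> A \<Longrightarrow> q \<in> A \<Longrightarrow> w \<in> A \<Longrightarrow> p \<noteq> q \<Longrightarrow> p \<noteq> w \<Longrightarrow> q \<noteq> w \<Longrightarrow> has_at_least 3 A"
  unfolding has_at_least_def by (intro exI[of _ "{p, q, w}"]) auto

context hammerstein_system
begin

abbreviation "I0 \<equiv> cond_I0 k g f a b \<gamma> \<delta> c d"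
abbreviation "I1 \<equiv> cond_I1 k g f"
abbreviation "sols \<equiv> nontrivial_solutions k g f (cone_K a b \<gamma> \<delta> c d)"

text \<open>
The situation in one ring: its two boundaries are of different kinds, in either order.
\<close>

definition alternates :: "(nat \<Rightarrow> real) \<Rightarrow> (nat \<Rightarrow> real) \<Rightarrow> bool" where
  "alternates \<rho> r \<longleftrightarrow> (\<forall>i\<in>{1,2}. 0 < \<rho> i \<and> \<rho> i < r i) \<and> (I0 \<rho> \<and> I1 r \<or> I1 \<rho> \<and> I0 r)"

lemma one_ring: "alternates \<rho> r \<Longrightarrow> has_at_least 1 sols"
  unfolding alternates_def by (metis solution_in_ring has_at_least_1)

lemma two_rings:
  assumes "alternates \<rho> r" "alternates r s" shows "has_at_least 2 sols"
proof -
  obtain p where "p \<in> sols" "scaled_C1_norm r p < 1"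
    using assms(1) unfolding alternates_def by (metis solution_in_ring)
  moreover obtain q where "q \<in> sols" "1 < scaled_C1_norm r q"
    using assms(2) unfolding alternates_def by (metis solution_in_ring)
  ultimately show ?thesis by (intro has_at_least_2[of p _ q]) auto
qed

lemma three_rings:
  assumes "alternates \<rho> r" "alternates r s" "alternates s \<sigma>" shows "has_at_least 3 sols"
proof -
  obtain p where p: "p \<in> sols" "scaled_C1_norm r p < 1"
    using assms(1) unfolding alternates_def by (metis solution_in_ring)
  obtain q where q: "q \<in> sols" "1 < scaled_C1_norm r q" "scaled_C1_norm s q < 1"
    using assms(2) unfolding alternates_def by (metis solution_in_ring)
  obtain w where w: "w \<in> sols" "1 < scaled_C1_norm s w"
    using assms(3) unfolding alternates_def by (metis solution_in_ring)
  \<comment> \<open>This separates the solution in the innermost ring from the one in the outermost ring.\<close>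
  have "scaled_C1_norm s p < 1" using scaled_C1_norm_less_1_mono[OF p(2)] assms(2) by (auto simp: alternates_def)
  then show ?thesis using p q w by (intro has_at_least_3[of p _ q w]) auto
qed

text \<open>
As \<open>c i \<le> 1\<close>, boxes whose radii are separated by the factor \<open>1 / c i\<close> are nested.
\<close>

lemma less_of_div_c:
  assumes "i \<in> {1,2}" "0 < \<rho>" "\<rho> / c i < r" shows "\<rho> < r"
proof -
  have "0 < c i" "c i \<le> 1" using assms(1) H1.c H2.c by auto
  then have "\<rho> \<le> \<rho> / c i" using assms(2) by (simp add: le_divide_eq mult_left_le)
  then show ?thesis using assms(3) by simp
qed

end

theorem theorem3p3:
  fixes k :: "nat \<Rightarrow> real \<Rightarrow> real \<Rightarrow> real"
    and f :: "nat \<Rightarrow> real \<Rightarrow> real \<times> real \<times> real \<times> real \<Rightarrow> real"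
    and g \<phi> \<psi> :: "nat \<Rightarrow> real \<Rightarrow> real"
    and a b \<gamma> \<delta> c d :: "nat \<Rightarrow> real"
  assumes "assm_A1 f"
    and "assm_A2 k"
    and "assm_A3 k a b \<gamma> \<delta> \<phi> \<psi> c d"
    and "assm_A4 g a b \<gamma> \<delta> \<phi> \<psi>"
  shows "(((\<exists>\<rho> r :: nat \<Rightarrow> real.
          (\<forall>i\<in>{1,2}. 0 < \<rho> i \<and> 0 < r i \<and> \<rho> i / c i < r i) \<and>
          cond_I0 k g f a b \<gamma> \<delta> c d \<rho> \<and> cond_I1 k g f r) \<or>
         (\<exists>\<rho> r :: nat \<Rightarrow> real.
          (\<forall>i\<in>{1,2}. 0 < \<rho> i \<and> 0 < r i \<and> \<rho> i < r i) \<and>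
          cond_I1 k g f \<rho> \<and> cond_I0 k g f a b \<gamma> \<delta> c d r))
         \<longrightarrow> has_at_least 1 (nontrivial_solutions k g f (cone_K a b \<gamma> \<delta> c d))) \<and>
        (((\<exists>\<rho> r s :: nat \<Rightarrow> real.
          (\<forall>i\<in>{1,2}. 0 < \<rho> i \<and> 0 < r i \<and> 0 < s i \<and> \<rho> i / c i < r i \<and> r i < s i) \<and>
          cond_I0 k g f a b \<gamma> \<delta> c d \<rho> \<and> cond_I1 k g f r \<and> cond_I0 k g f a b \<gamma> \<delta> c d s) \<or>
         (\<exists>\<rho> r s :: nat \<Rightarrow> real.
          (\<forall>i\<in>{1,2}. 0 < \<rho> i \<and> 0 < r i \<and> 0 < s i \<and> \<rho> i < r i \<and> r i / c i < s i) \<and>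
          cond_I1 k g f \<rho> \<and> cond_I0 k g f a b \<gamma> \<delta> c d r \<and> cond_I1 k g f s))
         \<longrightarrow> has_at_least 2 (nontrivial_solutions k g f (cone_K a b \<gamma> \<delta> c d))) \<and>
        (((\<exists>\<rho> r s \<sigma> :: nat \<Rightarrow> real.
          (\<forall>i\<in>{1,2}. 0 < \<rho> i \<and> 0 < r i \<and> 0 < s i \<and> 0 < \<sigma> i \<and> \<rho> i / c i < r i \<and> r i < s i \<and> s i / c i < \<sigma> i) \<and>
          cond_I0 k g f a b \<gamma> \<delta> c d \<rho> \<and> cond_I1 k g f r \<and> cond_I0 k g f a b \<gamma> \<delta> c d s \<and> cond_I1 k g f \<sigma>) \<or>
         (\<exists>\<rho> r s \<sigma> :: nat \<Rightarrow> real.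
          (\<forall>i\<in>{1,2}. 0 < \<rho> i \<and> 0 < r i \<and> 0 < s i \<and> 0 < \<sigma> i \<and> \<rho> i < r i \<and> r i / c i < s i \<and> s i < \<sigma> i) \<and>
          cond_I1 k g f \<rho> \<and> cond_I0 k g f a b \<gamma> \<delta> c d r \<and> cond_I1 k g f s \<and> cond_I0 k g f a b \<gamma> \<delta> c d \<sigma>))
         \<longrightarrow> has_at_least 3 (nontrivial_solutions k g f (cone_K a b \<gamma> \<delta> c d)))"
proof -
  interpret hammerstein_system k f g \<phi> \<psi> a b \<gamma> \<delta> c d
    by unfold_locales (rule assms)+
  show ?thesis
  proof (intro conjI impI; elim disjE exE conjE)
    fix \<rho> r assume "\<forall>i\<in>{1,2}. 0 < \<rho> i \<and> 0 < r i \<and> \<rho> i / c i < r i" "I0 \<rho>" "I1 r"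
    then have "alternates \<rho> r" unfolding alternates_def using less_of_div_c by blast
    then show "has_at_least 1 sols" by (rule one_ring)
  next
    fix \<rho> r assume "\<forall>i\<in>{1,2}. 0 < \<rho> i \<and> 0 < r i \<and> \<rho> i < r i" "I1 \<rho>" "I0 r"
    then have "alternates \<rho> r" unfolding alternates_def by blast
    then show "has_at_least 1 sols" by (rule one_ring)
  next
    fix \<rho> r s
    assume "\<forall>i\<in>{1,2}. 0 < \<rho> i \<and> 0 < r i \<and> 0 < s i \<and> \<rho> i / c i < r i \<and> r i < s i" "I0 \<rho>" "I1 r" "I0 s"
    then have "alternates \<rho> r" "alternates r s" unfolding alternates_def using less_of_div_c by blast+
    then show "has_at_least 2 sols" by (rule two_rings)
  next
    fix \<rho> r s
    assume "\<forall>i\<in>{1,2}. 0 < \<rho> i \<and> 0 < r i \<and> 0 < s i \<and> \<rho> i < r i \<and> r i / c i < s i" "I1 \<rho>" "I0 r" "I1 s"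
    then have "alternates \<rho> r" "alternates r s" unfolding alternates_def using less_of_div_c by blast+
    then show "has_at_least 2 sols" by (rule two_rings)
  next
    fix \<rho> r s \<sigma>
    assume "\<forall>i\<in>{1,2}. 0 < \<rho> i \<and> 0 < r i \<and> 0 < s i \<and> 0 < \<sigma> i \<and> \<rho> i / c i < r i \<and> r i < s i \<and> s i / c i < \<sigma> i"
      "I0 \<rho>" "I1 r" "I0 s" "I1 \<sigma>"
    then have "alternates \<rho> r" "alternates r s" "alternates s \<sigma>" unfolding alternates_def using less_of_div_c by blast+
    then show "has_at_least 3 sols" by (rule three_rings)
  next
    fix \<rho> r s \<sigma>
    assume "\<forall>i\<in>{1,2}. 0 < \<rho> i \<and> 0 < r i \<and> 0 < s i \<and> 0 < \<sigma> i \<and> \<rho> i < r i \<and> r i / c i < s i \<and> s i < \<sigma> i"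
      "I1 \<rho>" "I0 r" "I1 s" "I0 \<sigma>"
    then have "alternates \<rho> r" "alternates r s" "alternates s \<sigma>" unfolding alternates_def using less_of_div_c by blast+
    then show "has_at_least 3 sols" by (rule three_rings)
  qed
qed

end
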